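(* Let $\{f_1,\dots,f_N\}$ be a conformal iterated function system in $\mathbb{R}^n$ with invariant set $E$, and let $\{g_1,g_2\}$ be a conformal iterated function system in $\mathbb{R}^p$ consisting of exactly two maps, with invariant set $F$. Suppose that both systems satisfy the strong separation condition and that $E$ and $F$ have the same Hausdorff dimension $s$. If there are an $\mathcal{H}^s$ measurable subset $E'$ of $E$ with $\mathcal{H}^s(E')>0$ and a bilipschitz map $h:E'\to F$ (not necessarily onto), then there exists a bilipschitz map $\tilde h:E\to F$ with $\tilde h(E)=F$.
   Context: $\mathcal{H}^s$ denotes $s$-dimensional Hausdorff measure. A map $h:A\to B$, $A\subset\mathbb{R}^n$, $B\subset\mathbb{R}^p$, is bilipschitz if there is $L<\infty$ such that $|x-y|/L\le |h(x)-h(y)|\le L|x-y|$ for all $x,y\in A$; $h$ is not required to be onto $B$. A conformal iterated function system in $\mathbb{R}^n$ is a finite family $\{f_1,\dots,f_N\}$, $N\ge 2$, for which there is an open connected set $V\subset\mathbb{R}^n$ such that each $f_i:V\to V$ is an injective conformal map (its derivative at every point is a nonzero multiple of an orthogonal map) of class $C^{1+\gamma}$ for some fixed $\gamma>0$ (the partial derivatives are Hölder continuous with exponent $\gamma$), there is a constant $L_0<1$ with $|f_i(x)-f_i(y)|\le L_0|x-y|$ for all $x,y\in V$ and $i=1,\dots,N$, and there are constants $0<c_1<C_1<1$ such that $c_1\le \|Df_i(x)\|\le C_1$ for all $x\in V$, $i=1,\dots,N$, where $\|\cdot\|$ is the operator norm. Its invariant set is the unique nonempty compact set $E\subset V$ with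 $E=\bigcup_{i=1}^N f_i(E)$. Standing assumption on all systems: the open set condition holds, that is, there is a nonempty bounded open set $O\subset V$ whose closure is contained in $V$ and such that the sets $f_i(O)$, $i=1,\dots,N$, are pairwise disjoint subsets of $O$. The strong separation condition holds if the sets $f_i(E)$, $i=1,\dots,N$, are pairwise disjoint. The system $\{g_1,g_2\}$ in $\mathbb{R}^p$ is understood in the same sense, with its own domain and constants. *)

theory Defs
  imports "HOL-Analysis.Analysis"
begin

section \<open>Hausdorff measure and dimension\<close>

text \<open>
  The convention \<open>diam(U)\<^sup>0 = 1\<close> for nonempty \<open>U\<close> has to be written out, since
  \<open>0 powr 0 = 0\<close>; with it \<open>\<H>\<^sup>0\<close> is counting measure.
\<close>

definition diam_pow :: "real \<Rightarrow> 'a::metric_space set \<Rightarrow> ennreal" where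
  "diam_pow s U =
     (if U = {} then 0 else if s = 0 then 1 else ennreal (diameter U powr s))"

text \<open>
  The covering sets are required to be bounded because \<^const>\<open>diameter\<close> is unspecified on
  unbounded sets. Finite covers are included, as \<open>U i = {}\<close> is allowed.
\<close>

definition hausdorff_premeasure :: "real \<Rightarrow> real \<Rightarrow> 'a::metric_space set \<Rightarrow> ennreal" where
  "hausdorff_premeasure \<delta> s A =
     (INF U \<in> {U :: nat \<Rightarrow> 'a set.
                 A \<subseteq> (\<Union>i. U i) \<and> (\<forall>i. bounded (U i) \<and> diameter (U i) \<le> \<delta>)}.
        \<Sum>i. diam_pow s (U i))"

definition hausdorff_measure :: "real \<Rightarrow> 'a::metric_space set \<Rightarrow> ennreal" where
  "hausdorff_measure s A = (SUP \<delta> \<in> {0<..}. hausdorff_premeasure \<delta> s A)"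

text \<open>Measurability in the sense of Caratheodory for the outer measure \<open>\<H>\<^sup>s\<close>.\<close>

definition hausdorff_measurable :: "real \<Rightarrow> 'a::metric_space set \<Rightarrow> bool" where
  "hausdorff_measurable s A \<longleftrightarrow> A \<in> lambda_system UNIV UNIV (hausdorff_measure s)"

definition hausdorff_dim :: "'a::metric_space set \<Rightarrow> ereal" where
  "hausdorff_dim A = (INF s \<in> {s. 0 \<le> s \<and> hausdorff_measure s A = 0}. ereal s)"


section \<open>Bilipschitz maps\<close>

text \<open>
  The map need not be onto \<open>B\<close>. The condition \<open>0 < L\<close> excludes \<open>L = 0\<close>, for which
  \<open>dist x y / L = 0\<close> would let constant maps through.
\<close>

definition bilipschitz_map ::
    "('a::metric_space \<Rightarrow> 'b::metric_space) \<Rightarrow> 'a set \<Rightarrow> 'b set \<Rightarrow> bool" where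
  "bilipschitz_map h A B \<longleftrightarrow>
     h ` A \<subseteq> B \<and>
     (\<exists>L>0. \<forall>x\<in>A. \<forall>y\<in>A.
        dist x y / L \<le> dist (h x) (h y) \<and> dist (h x) (h y) \<le> L * dist x y)"


section \<open>Conformal iterated function systems\<close>

definition conformal_on :: "'a::euclidean_space set \<Rightarrow> ('a \<Rightarrow> 'a) \<Rightarrow> bool" where
  "conformal_on V f \<longleftrightarrow>
     (\<forall>x\<in>V. f differentiable (at x) \<and>
        (\<exists>c T. c \<noteq> 0 \<and> orthogonal_transformation T \<and>
               frechet_derivative f (at x) = (\<lambda>v. c *\<^sub>R T v)))"

text \<open>
  For \<open>b \<in> Basis\<close>, \<open>frechet_derivative f (at x) b\<close> is the vector of partial derivatives
  of the components of \<open>f\<close> in the direction \<open>b\<close>.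
\<close>

definition C1_holder_on :: "real \<Rightarrow> 'a::euclidean_space set \<Rightarrow> ('a \<Rightarrow> 'a) \<Rightarrow> bool" where
  "C1_holder_on \<gamma> V f \<longleftrightarrow>
     (\<forall>x\<in>V. f differentiable (at x)) \<and>
     (\<exists>K. \<forall>b\<in>Basis. \<forall>x\<in>V. \<forall>y\<in>V.
        norm (frechet_derivative f (at x) b - frechet_derivative f (at y) b)
          \<le> K * dist x y powr \<gamma>)"

text \<open>
  The maps \<open>f 1, \<dots>, f N\<close> are total functions, but only their restrictions to the
  domain \<open>V\<close> matter.
\<close>

definition conformal_ifs ::
    "'a::euclidean_space set \<Rightarrow> nat \<Rightarrow> (nat \<Rightarrow> 'a \<Rightarrow> 'a) \<Rightarrow> bool" where
  "conformal_ifs V N f \<longleftrightarrow>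
     2 \<le> N \<and> open V \<and> connected V \<and>
     (\<forall>i\<in>{1..N}. f i ` V \<subseteq> V \<and> inj_on (f i) V \<and> conformal_on V (f i)) \<and>
     (\<exists>\<gamma>>0. \<forall>i\<in>{1..N}. C1_holder_on \<gamma> V (f i)) \<and>
     (\<exists>L0<1. \<forall>i\<in>{1..N}. \<forall>x\<in>V. \<forall>y\<in>V. dist (f i x) (f i y) \<le> L0 * dist x y) \<and>
     (\<exists>c1 C1. 0 < c1 \<and> c1 < C1 \<and> C1 < 1 \<and>
        (\<forall>i\<in>{1..N}. \<forall>x\<in>V.
           c1 \<le> onorm (frechet_derivative (f i) (at x)) \<and>
           onorm (frechet_derivative (f i) (at x)) \<le> C1))"

definition open_set_condition ::
    "'a::euclidean_space set \<Rightarrow> nat \<Rightarrow> (nat \<Rightarrow> 'a \<Rightarrow> 'a) \<Rightarrow> bool" where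
  "open_set_condition V N f \<longleftrightarrow>
     (\<exists>U. U \<noteq> {} \<and> bounded U \<and> open U \<and> closure U \<subseteq> V \<and>
        (\<forall>i\<in>{1..N}. f i ` U \<subseteq> U) \<and> disjoint_family_on (\<lambda>i. f i ` U) {1..N})"

definition invariant_set ::
    "'a::euclidean_space set \<Rightarrow> nat \<Rightarrow> (nat \<Rightarrow> 'a \<Rightarrow> 'a) \<Rightarrow> 'a set \<Rightarrow> bool" where
  "invariant_set V N f E \<longleftrightarrow>
     E \<noteq> {} \<and> compact E \<and> E \<subseteq> V \<and> E = (\<Union>i\<in>{1..N}. f i ` E)"

definition strong_separation ::
    "nat \<Rightarrow> (nat \<Rightarrow> 'a \<Rightarrow> 'a) \<Rightarrow> 'a set \<Rightarrow> bool" where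
  "strong_separation N f E \<longleftrightarrow> disjoint_family_on (\<lambda>i. f i ` E) {1..N}"

end

theory Submission
  imports Defs
begin

text \<open>
  By conformality and the Hoelder condition, all compositions of the \<open>f\<^sub>i\<close> are, on \<open>E\<close>, similarities up
  to a uniform bilipschitz constant. Magnifying \<open>h\<close> along cylinders of \<open>E\<close> in which \<open>E'\<close> gets
  denser and denser, and passing to a limit, gives a bilipschitz embedding of \<open>E\<close> into \<open>F\<close>. Its image has
  positive measure; magnifying the inverse map along cylinders of \<open>F\<close> in which the image gets denser and
  denser gives in the limit a bilipschitz embedding of \<open>F\<close> into \<open>E\<close> whose image contains a whole
  cylinder of \<open>E\<close>. Hence \<open>E\<close>, being bilipschitz equivalent to each of its cylinders, is bilipschitz
  equivalent to a nonempty relatively clopen subset of \<open>F\<close>, that is, to a finite union of cylinders. Since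
  \<open>F\<close> is generated by two maps, it is itself equivalent to every nonempty finite union of its cylinders, by
  induction on their level.
\<close>

section \<open>Hausdorff measure\<close>

text \<open>Bilipschitz maps are handled as relations bounded in both directions. The converse of
  such a relation is again one, so a single blow-up argument serves from \<open>E\<close> to
  \<open>F\<close> and back. Denseness of a set in a cylinder is metric: it meets every subcylinder
  \<open>q\<close> levels down. Finding such cylinders rests on the measure of \<open>E\<close>
  being finite, and it is finite because a cylinder sum above 1 at the exponent \<open>s\<close>
  would force a larger dimension. The obstacle is that a limit of blow-ups need not have a large
  range: of the image of the first limit only positive measure is known. For the way back, the
  blown-up relation has full range, and the gaps around cylinders show that every blow-up covers a
  whole cylinder of a level independent of \<open>q\<close>. Two maps matter at the end: a node of a
  binary tree has one or two occupied children, and both cases lead back to the full set. With three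
  children, two may be occupied, and nothing identifies their union with the whole.\<close>

lemma diam_pow_eq: "s > 0 \<Longrightarrow> diam_pow s U = ennreal (diameter U powr s)"
  by (simp add: diam_pow_def)

lemma diam_pow_empty [simp]: "diam_pow s {} = 0"
  by (simp add: diam_pow_def)

lemma diameter_leI:
  assumes "\<And>x y. x \<in> S \<Longrightarrow> y \<in> S \<Longrightarrow> dist x y \<le> d" "d \<ge> 0"
  shows "diameter S \<le> d"
  using assms by (auto simp: diameter_def intro!: cSUP_least)

lemma hausdorff_premeasure_le:
  assumes "A \<subseteq> (\<Union>i. U i)" "\<And>i. bounded (U i)" "\<And>i. diameter (U i) \<le> \<delta>"
  shows "hausdorff_premeasure \<delta> s A \<le> (\<Sum>i. diam_pow s (U i))"
  unfolding hausdorff_premeasure_def by (rule INF_lower) (use assms in auto)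

lemma hausdorff_premeasure_greatest:
  assumes "\<And>U :: nat \<Rightarrow> _. A \<subseteq> (\<Union>i. U i) \<Longrightarrow> (\<And>i. bounded (U i)) \<Longrightarrow>
             (\<And>i. diameter (U i) \<le> \<delta>) \<Longrightarrow> x \<le> (\<Sum>i. diam_pow s (U i))"
  shows "x \<le> hausdorff_premeasure \<delta> s A"
  unfolding hausdorff_premeasure_def by (rule INF_greatest) (use assms in auto)

lemma hausdorff_premeasure_mono:
  "A \<subseteq> B \<Longrightarrow> hausdorff_premeasure \<delta> s A \<le> hausdorff_premeasure \<delta> s B"
  by (intro hausdorff_premeasure_greatest hausdorff_premeasure_le) auto

lemma hausdorff_premeasure_antimono:
  "\<delta> \<le> \<delta>' \<Longrightarrow> hausdorff_premeasure \<delta>' s A \<le> hausdorff_premeasure \<delta> s A"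
  by (intro hausdorff_premeasure_greatest hausdorff_premeasure_le) (auto intro: order_trans)

lemma hausdorff_premeasure_le_measure:
  "\<delta> > 0 \<Longrightarrow> hausdorff_premeasure \<delta> s A \<le> hausdorff_measure s A"
  unfolding hausdorff_measure_def by (rule SUP_upper) auto

lemma hausdorff_measure_least:
  assumes "\<And>\<delta>. \<delta> > 0 \<Longrightarrow> hausdorff_premeasure \<delta> s A \<le> x"
  shows "hausdorff_measure s A \<le> x"
  unfolding hausdorff_measure_def by (rule SUP_least) (use assms in auto)

lemma hausdorff_measure_mono:
  "A \<subseteq> B \<Longrightarrow> hausdorff_measure s A \<le> hausdorff_measure s B"
  by (intro hausdorff_measure_least)
     (meson hausdorff_premeasure_mono hausdorff_premeasure_le_measure order_trans)

lemma hausdorff_premeasure_le_diam_pow: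
  assumes "bounded A" "diameter A \<le> \<delta>" "\<delta> \<ge> 0"
  shows "hausdorff_premeasure \<delta> s A \<le> diam_pow s A"
proof -
  have "hausdorff_premeasure \<delta> s A \<le> (\<Sum>i. diam_pow s (if i = (0::nat) then A else {}))"
    by (rule hausdorff_premeasure_le) (use assms in auto)
  also have "\<dots> = (\<Sum>i\<in>{0}. diam_pow s (if i = (0::nat) then A else {}))"
    by (rule suminf_finite) auto
  finally show ?thesis by simp
qed

lemma hausdorff_premeasure_empty: "\<delta> \<ge> 0 \<Longrightarrow> hausdorff_premeasure \<delta> s {} = 0"
  using hausdorff_premeasure_le_diam_pow[of "{}" \<delta> s] by simp

lemma hausdorff_measure_empty [simp]: "hausdorff_measure s {} = 0"
  using hausdorff_measure_least[of s "{}" 0] by (simp add: hausdorff_premeasure_empty)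

lemma hausdorff_premeasure_Un:
  "hausdorff_premeasure \<delta> s (A \<union> B) \<le> hausdorff_premeasure \<delta> s A + hausdorff_premeasure \<delta> s B"
proof -
  have main: "hausdorff_premeasure \<delta> s (A \<union> B) \<le> (\<Sum>i. diam_pow s (U i)) + (\<Sum>i. diam_pow s (V i))"
    if U: "A \<subseteq> (\<Union>i. U i)" "\<And>i. bounded (U i)" "\<And>i. diameter (U i) \<le> \<delta>"
    and V: "B \<subseteq> (\<Union>i. V i)" "\<And>i. bounded (V i)" "\<And>i. diameter (V i) \<le> \<delta>"
    for U V :: "nat \<Rightarrow> 'a set"
  proof -
    define W where "W i = (if even i then U (i div 2) else V (i div 2))" for i
    have [simp]: "W (2 * i) = U i" "W (Suc (2 * i)) = V i" for i
      by (auto simp: W_def)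
    have "A \<union> B \<subseteq> (\<Union>i. W i)"
    proof
      fix x assume "x \<in> A \<union> B"
      then obtain i where "x \<in> U i \<or> x \<in> V i" using U(1) V(1) by blast
      then have "x \<in> W (2 * i) \<or> x \<in> W (Suc (2 * i))" by simp
      then show "x \<in> (\<Union>i. W i)" by blast
    qed
    then have "hausdorff_premeasure \<delta> s (A \<union> B) \<le> (\<Sum>i. diam_pow s (W i))"
      by (rule hausdorff_premeasure_le) (use U V in \<open>auto simp: W_def\<close>)
    also have "\<dots> \<le> (\<Sum>i. diam_pow s (U i)) + (\<Sum>i. diam_pow s (V i))"
    proof (rule suminf_le_const)
      show "summable (\<lambda>i. diam_pow s (W i))" by simp
      fix n
      have eq: "(\<Sum>i<2*n. diam_pow s (W i)) = (\<Sum>i<n. diam_pow s (U i) + diam_pow s (V i))" for n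
        by (induction n) (simp_all add: add.assoc)
      have "(\<Sum>i<n. diam_pow s (W i)) \<le> (\<Sum>i<2*n. diam_pow s (W i))"
        by (rule sum_mono2) auto
      also have "\<dots> \<le> (\<Sum>i. diam_pow s (U i)) + (\<Sum>i. diam_pow s (V i))"
        unfolding eq sum.distrib by (intro add_mono sum_le_suminf) auto
      finally show "(\<Sum>i<n. diam_pow s (W i)) \<le> (\<Sum>i. diam_pow s (U i)) + (\<Sum>i. diam_pow s (V i))" .
    qed
    finally show ?thesis .
  qed
  show ?thesis
  proof (cases "hausdorff_premeasure \<delta> s A = top \<or> hausdorff_premeasure \<delta> s B = top")
    case False
    show ?thesis
    proof (rule ennreal_le_epsilon)
      fix e :: real assume e: "e > 0"
      have ex: "\<exists>U::nat \<Rightarrow> 'a set. X \<subseteq> (\<Union>i. U i) \<and> (\<forall>i. bounded (U i)) \<and> (\<forall>i. diameter (U i) \<le> \<delta>) \<and>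
          (\<Sum>i. diam_pow s (U i)) < hausdorff_premeasure \<delta> s X + ennreal (e / 2)"
        if "hausdorff_premeasure \<delta> s X \<noteq> top" for X
      proof -
        have "hausdorff_premeasure \<delta> s X < hausdorff_premeasure \<delta> s X + ennreal (e / 2)"
          using that e by (simp add: ennreal_add_left_cancel_less less_top)
        then show ?thesis
          unfolding hausdorff_premeasure_def INF_less_iff by auto
      qed
      obtain U V where "A \<subseteq> (\<Union>i. U i)" "\<And>i. bounded (U i)" "\<And>i. diameter (U i) \<le> \<delta>"
        "B \<subseteq> (\<Union>i. V i)" "\<And>i. bounded (V i)" "\<And>i. diameter (V i) \<le> \<delta>"
        and lt: "(\<Sum>i. diam_pow s (U i)) < hausdorff_premeasure \<delta> s A + ennreal (e / 2)"
         "(\<Sum>i. diam_pow s (V i)) < hausdorff_premeasure \<delta> s B + ennreal (e / 2)"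
        using ex[of A] ex[of B] False by blast
      then have "hausdorff_premeasure \<delta> s (A \<union> B) \<le> (\<Sum>i. diam_pow s (U i)) + (\<Sum>i. diam_pow s (V i))"
        by (intro main)
      also have "\<dots> \<le> (hausdorff_premeasure \<delta> s A + ennreal (e / 2)) + (hausdorff_premeasure \<delta> s B + ennreal (e / 2))"
        using lt by (intro add_mono) auto
      also have "\<dots> = hausdorff_premeasure \<delta> s A + hausdorff_premeasure \<delta> s B + (ennreal (e / 2) + ennreal (e / 2))"
        by (simp add: ac_simps)
      also have "ennreal (e / 2) + ennreal (e / 2) = ennreal e"
        using e by (simp flip: ennreal_plus)
      finally show "hausdorff_premeasure \<delta> s (A \<union> B) \<le> hausdorff_premeasure \<delta> s A + hausdorff_premeasure \<delta> s B + ennreal e" .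
    qed
  qed auto
qed

lemma hausdorff_premeasure_UN_finite:
  assumes "finite I" "\<delta> \<ge> 0"
  shows "hausdorff_premeasure \<delta> s (\<Union>i\<in>I. A i) \<le> (\<Sum>i\<in>I. hausdorff_premeasure \<delta> s (A i))"
  using assms(1)
proof induction
  case empty
  then show ?case using assms(2) by (simp add: hausdorff_premeasure_empty)
next
  case (insert i I)
  have "hausdorff_premeasure \<delta> s (\<Union>i\<in>insert i I. A i)
      \<le> hausdorff_premeasure \<delta> s (A i) + hausdorff_premeasure \<delta> s (\<Union>i\<in>I. A i)"
    using hausdorff_premeasure_Un[of \<delta> s "A i" "\<Union>i\<in>I. A i"] by simp
  then show ?case using insert by (simp add: add_left_mono order_trans)
qed

lemma hausdorff_measure_UN_finite_le:
  assumes "finite I"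
  shows "hausdorff_measure s (\<Union>i\<in>I. A i) \<le> (\<Sum>i\<in>I. hausdorff_measure s (A i))"
proof (rule hausdorff_measure_least)
  fix \<delta> :: real assume "\<delta> > 0"
  then have "hausdorff_premeasure \<delta> s (\<Union>i\<in>I. A i) \<le> (\<Sum>i\<in>I. hausdorff_premeasure \<delta> s (A i))"
    using assms by (intro hausdorff_premeasure_UN_finite) auto
  also have "\<dots> \<le> (\<Sum>i\<in>I. hausdorff_measure s (A i))"
    using \<open>\<delta> > 0\<close> by (intro sum_mono hausdorff_premeasure_le_measure)
  finally show "hausdorff_premeasure \<delta> s (\<Union>i\<in>I. A i) \<le> \<dots>" .
qed

text \<open>A set of diameter at most \<open>\<delta>\<close> cannot meet both \<open>A\<close> and
  \<open>B\<close>, so the members of a cover of the union can be distributed between two covers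
  without paying for any set twice.\<close>

lemma hausdorff_premeasure_separated:
  assumes sep: "\<And>x y. x \<in> A \<Longrightarrow> y \<in> B \<Longrightarrow> \<delta> < dist x y"
  shows "hausdorff_premeasure \<delta> s A + hausdorff_premeasure \<delta> s B \<le> hausdorff_premeasure \<delta> s (A \<union> B)"
proof (rule hausdorff_premeasure_greatest)
  fix U :: "nat \<Rightarrow> 'a set"
  assume U: "A \<union> B \<subseteq> (\<Union>i. U i)" "\<And>i. bounded (U i)" "\<And>i. diameter (U i) \<le> \<delta>"
  have \<delta>: "\<delta> \<ge> 0" using U(3)[of 0] diameter_ge_0[OF U(2)[of 0]] by linarith
  define P where "P X i = (if U i \<inter> X = {} then {} else U i)" for X i
  have *: "hausdorff_premeasure \<delta> s X \<le> (\<Sum>i. diam_pow s (P X i))" if "X \<subseteq> A \<union> B" for X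
  proof (rule hausdorff_premeasure_le)
    show "X \<subseteq> (\<Union>i. P X i)" using U(1) that by (fastforce simp: P_def)
  qed (use U \<delta> in \<open>auto simp: P_def\<close>)
  have "hausdorff_premeasure \<delta> s A + hausdorff_premeasure \<delta> s B
      \<le> (\<Sum>i. diam_pow s (P A i)) + (\<Sum>i. diam_pow s (P B i))"
    by (intro add_mono *) auto
  also have "\<dots> = (\<Sum>i. diam_pow s (P A i) + diam_pow s (P B i))"
    by (rule suminf_add) auto
  also have "\<dots> \<le> (\<Sum>i. diam_pow s (U i))"
  proof (rule suminf_le)
    fix i
    have "U i \<inter> A = {} \<or> U i \<inter> B = {}"
    proof (rule ccontr)
      assume "\<not> ?thesis"
      then obtain x y where "x \<in> U i" "y \<in> U i" "x \<in> A" "y \<in> B" by blast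
      then show False
        using sep[of x y] diameter_bounded_bound[OF U(2)[of i], of x y] U(3)[of i] by linarith
    qed
    then show "diam_pow s (P A i) + diam_pow s (P B i) \<le> diam_pow s (U i)"
      by (auto simp: P_def)
  qed auto
  finally show "hausdorff_premeasure \<delta> s A + hausdorff_premeasure \<delta> s B \<le> (\<Sum>i. diam_pow s (U i))" .
qed

text \<open>This is the defining property of a metric outer measure. Premeasures grow as the scale
  shrinks, so both suprema can be taken along a common scale, eventually below
  \<open>d\<close>.\<close>

lemma hausdorff_measure_separated:
  assumes d: "d > 0" and sep: "\<And>x y. x \<in> A \<Longrightarrow> y \<in> B \<Longrightarrow> d \<le> dist x y"
  shows "hausdorff_measure s A + hausdorff_measure s B \<le> hausdorff_measure s (A \<union> B)"
proof -
  have "hausdorff_measure s A + hausdorff_measure s B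
     = (SUP \<delta>\<in>{0<..}. hausdorff_premeasure \<delta> s A + hausdorff_premeasure \<delta> s B)"
    unfolding hausdorff_measure_def
  proof (rule SUP_add_directed_ennreal [symmetric])
    fix a b :: real assume "a \<in> {0<..}" "b \<in> {0<..}"
    then show "\<exists>k\<in>{0<..}. hausdorff_premeasure a s A + hausdorff_premeasure b s B
           \<le> hausdorff_premeasure k s A + hausdorff_premeasure k s B"
      by (intro bexI[of _ "min a b"] add_mono hausdorff_premeasure_antimono) auto
  qed
  also have "\<dots> \<le> hausdorff_measure s (A \<union> B)"
  proof (rule SUP_least)
    fix \<delta> :: real assume "\<delta> \<in> {0<..}"
    \<comment> \<open>Half of \<open>d\<close>, because the premeasure version needs distances
      strictly above the scale.\<close>
    define e where "e = min \<delta> (d / 2)"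
    have e: "e > 0" "e < d" "e \<le> \<delta>" using d \<open>\<delta> \<in> _\<close> by (auto simp: e_def)
    have "hausdorff_premeasure \<delta> s A + hausdorff_premeasure \<delta> s B
       \<le> hausdorff_premeasure e s A + hausdorff_premeasure e s B"
      by (intro add_mono hausdorff_premeasure_antimono e)
    also have "\<dots> \<le> hausdorff_premeasure e s (A \<union> B)"
      by (rule hausdorff_premeasure_separated) (use sep e in fastforce)
    also have "\<dots> \<le> hausdorff_measure s (A \<union> B)" by (rule hausdorff_premeasure_le_measure) fact
    finally show "hausdorff_premeasure \<delta> s A + hausdorff_premeasure \<delta> s B \<le> \<dots>" .
  qed
  finally show ?thesis .
qed

text \<open>Disjoint compact sets lie at positive distance, which reduces additivity over cylinders
  to the separated case, one set at a time.\<close>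

lemma hausdorff_measure_UN_compact:
  fixes A :: "'i \<Rightarrow> 'a::heine_borel set"
  assumes "finite I" "disjoint_family_on A I" "\<And>i. i \<in> I \<Longrightarrow> compact (A i)"
  shows "(\<Sum>i\<in>I. hausdorff_measure s (A i)) \<le> hausdorff_measure s (\<Union>i\<in>I. A i)"
  using assms
proof (induction I)
  case (insert i I)
  have "compact (\<Union>i\<in>I. A i)" using insert by (intro compact_UN) auto
  moreover have "A i \<inter> (\<Union>i\<in>I. A i) = {}"
    using insert(2,4) by (fastforce simp: disjoint_family_on_def)
  ultimately have "\<exists>d>0. \<forall>x\<in>A i. \<forall>y\<in>(\<Union>i\<in>I. A i). d \<le> dist x y"
    by (intro separate_compact_closed compact_imp_closed insert(5)) auto
  then obtain d where d: "d > 0" "\<And>x y. x \<in> A i \<Longrightarrow> y \<in> (\<Union>i\<in>I. A i) \<Longrightarrow> d \<le> dist x y"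
    by metis
  have "(\<Sum>i\<in>I. hausdorff_measure s (A i)) \<le> hausdorff_measure s (\<Union>i\<in>I. A i)"
    using insert by (intro insert.IH) (auto simp: disjoint_family_on_def)
  then have "(\<Sum>i\<in>insert i I. hausdorff_measure s (A i))
     \<le> hausdorff_measure s (A i) + hausdorff_measure s (\<Union>i\<in>I. A i)"
    using insert by (simp add: add_left_mono)
  also have "\<dots> \<le> hausdorff_measure s (A i \<union> (\<Union>i\<in>I. A i))"
    by (rule hausdorff_measure_separated[OF d])
  finally show ?case by simp
qed auto

text \<open>A cover at scale \<open>\<delta> / c\<close> is pushed forward after intersecting it
  with \<open>A\<close>, since the Lipschitz bound holds only there.\<close>

lemma hausdorff_measure_lipschitz_image:
  fixes f :: "'a::metric_space \<Rightarrow> 'b::metric_space"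
  assumes s: "s > 0" and c: "c > 0" and lip: "\<And>x y. x \<in> A \<Longrightarrow> y \<in> A \<Longrightarrow> dist (f x) (f y) \<le> c * dist x y"
  shows "hausdorff_measure s (f ` A) \<le> ennreal (c powr s) * hausdorff_measure s A"
proof (rule hausdorff_measure_least)
  fix \<delta> :: real assume \<delta>: "\<delta> > 0"
  have "hausdorff_premeasure \<delta> s (f ` A) \<le> (\<Sum>i. ennreal (c powr s) * diam_pow s (U i))"
    if U: "A \<subseteq> (\<Union>i. U i)" "\<And>i. bounded (U i)" "\<And>i. diameter (U i) \<le> \<delta> / c" for U :: "nat \<Rightarrow> 'a set"
  proof -
    have bd: "dist x y \<le> c * diameter (U i)" if "x \<in> f ` (U i \<inter> A)" "y \<in> f ` (U i \<inter> A)" for x y i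
    proof -
      obtain x' y' where *: "x = f x'" "y = f y'" "x' \<in> U i \<inter> A" "y' \<in> U i \<inter> A" using \<open>x \<in> _\<close> \<open>y \<in> _\<close> by blast
      then have "dist x y \<le> c * dist x' y'" using lip by auto
      also have "\<dots> \<le> c * diameter (U i)"
        using * c diameter_bounded_bound[OF U(2), of x' i y'] by (intro mult_left_mono) auto
      finally show ?thesis .
    qed
    have diam: "diameter (f ` (U i \<inter> A)) \<le> c * diameter (U i)" for i
      by (rule diameter_leI) (use bd c diameter_ge_0[OF U(2)] in auto)
    have "hausdorff_premeasure \<delta> s (f ` A) \<le> (\<Sum>i. diam_pow s (f ` (U i \<inter> A)))"
    proof (rule hausdorff_premeasure_le)
      show "f ` A \<subseteq> (\<Union>i. f ` (U i \<inter> A))" using U(1) by blast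
      show "bounded (f ` (U i \<inter> A))" for i
        unfolding bounded_two_points using bd[of _ i] by blast
      have "c * diameter (U i) \<le> \<delta>" for i using U(3)[of i] c by (simp add: field_simps)
      then show "diameter (f ` (U i \<inter> A)) \<le> \<delta>" for i using diam[of i] order_trans by blast
    qed
    also have "\<dots> \<le> (\<Sum>i. ennreal (c powr s) * diam_pow s (U i))"
    proof (rule suminf_le)
      fix i
      have "0 \<le> diameter (f ` (U i \<inter> A))"
        by (rule diameter_ge_0) (use bd[of _ i] in \<open>auto simp: bounded_two_points\<close>)
      then have "diameter (f ` (U i \<inter> A)) powr s \<le> (c * diameter (U i)) powr s"
        using diam s by (intro powr_mono2) auto
      also have "\<dots> = c powr s * diameter (U i) powr s"
        using c diameter_ge_0[OF U(2)] by (simp add: powr_mult)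
      finally show "diam_pow s (f ` (U i \<inter> A)) \<le> ennreal (c powr s) * diam_pow s (U i)"
        using s by (simp add: diam_pow_eq flip: ennreal_mult)
    qed auto
    finally show ?thesis .
  qed
  then have *: "hausdorff_premeasure \<delta> s (f ` A) \<le> ennreal (c powr s) * (\<Sum>i. diam_pow s (U i))"
    if "A \<subseteq> (\<Union>i. U i)" "\<And>i. bounded (U i)" "\<And>i. diameter (U i) \<le> \<delta> / c" for U :: "nat \<Rightarrow> 'a set"
    using that by (simp add: ennreal_suminf_cmult)
  have cs: "0 < ennreal (c powr s)" "ennreal (c powr s) \<noteq> top" using c by auto
  \<comment> \<open>Dividing by the constant turns the bound, valid for each cover, into a lower
    bound for the infimum over all covers.\<close>
  have "hausdorff_premeasure \<delta> s (f ` A) / ennreal (c powr s) \<le> hausdorff_premeasure (\<delta> / c) s A"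
    by (rule hausdorff_premeasure_greatest, rule divide_le_posI_ennreal) (use * cs in auto)
  then have "hausdorff_premeasure \<delta> s (f ` A) / ennreal (c powr s) \<le> hausdorff_measure s A"
    using hausdorff_premeasure_le_measure[of "\<delta> / c" s A] \<delta> c by (simp add: order_trans)
  then have "(hausdorff_premeasure \<delta> s (f ` A) / ennreal (c powr s)) * ennreal (c powr s)
       \<le> hausdorff_measure s A * ennreal (c powr s)" by (rule mult_right_mono) auto
  then show "hausdorff_premeasure \<delta> s (f ` A) \<le> ennreal (c powr s) * hausdorff_measure s A"
    using cs ennreal_mult_divide_eq[of "ennreal (c powr s)" "hausdorff_premeasure \<delta> s (f ` A)"]
    by (metis ennreal_divide_times ennreal_times_divide mult.commute less_irrefl)
qed

section \<open>Dependence on the exponent, and dimension\<close>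

lemma hausdorff_measure_exponent_antimono:
  assumes "0 \<le> u" "u \<le> t"
  shows "hausdorff_measure t A \<le> hausdorff_measure u A"
proof (rule hausdorff_measure_least)
  fix \<delta> :: real assume \<delta>: "\<delta> > 0"
  \<comment> \<open>Only for diameters up to 1 does a larger exponent give a smaller power, so the
    scale is first cut at 1.\<close>
  have "hausdorff_premeasure \<delta> t A \<le> hausdorff_premeasure (min \<delta> 1) t A"
    by (rule hausdorff_premeasure_antimono) auto
  also have "\<dots> \<le> hausdorff_premeasure (min \<delta> 1) u A"
  proof (rule hausdorff_premeasure_greatest)
    fix U :: "nat \<Rightarrow> 'a set"
    assume U: "A \<subseteq> (\<Union>i. U i)" "\<And>i. bounded (U i)" "\<And>i. diameter (U i) \<le> min \<delta> 1"
    have "hausdorff_premeasure (min \<delta> 1) t A \<le> (\<Sum>i. diam_pow t (U i))"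
      by (rule hausdorff_premeasure_le) (use U in auto)
    also have "\<dots> \<le> (\<Sum>i. diam_pow u (U i))"
    proof (rule suminf_le)
      fix i
      have d: "0 \<le> diameter (U i)" "diameter (U i) \<le> 1" using U(3)[of i] diameter_ge_0[OF U(2)] by auto
      show "diam_pow t (U i) \<le> diam_pow u (U i)"
        using d assms powr_mono'[of u t "diameter (U i)"] powr_le1[of t "diameter (U i)"]
        by (auto simp: diam_pow_def)
    qed auto
    finally show "hausdorff_premeasure (min \<delta> 1) t A \<le> (\<Sum>i. diam_pow u (U i))" .
  qed
  also have "\<dots> \<le> hausdorff_measure u A" using \<delta> by (intro hausdorff_premeasure_le_measure) auto
  finally show "hausdorff_premeasure \<delta> t A \<le> hausdorff_measure u A" .
qed

lemma hausdorff_dim_ge: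
  assumes "hausdorff_measure t A > 0"
  shows "ereal t \<le> hausdorff_dim A"
  unfolding hausdorff_dim_def
proof (rule INF_greatest)
  fix u assume u: "u \<in> {s. 0 \<le> s \<and> hausdorff_measure s A = 0}"
  show "ereal t \<le> ereal u"
    using hausdorff_measure_exponent_antimono[of u t A] assms u by force
qed

section \<open>Positivity of Hausdorff measure\<close>

text \<open>
  The mass distribution principle without a measure: covering sets of diameter below \<open>\<delta>\<close> meet only
  one of the pieces \<open>\<phi> i ` E\<close>, so pulling them back along \<open>\<phi> i\<close> gives covers of \<open>E\<close> by fewer sets.
\<close>

lemma sum_diameter_powr_ge:
  fixes E :: "'a::metric_space set" and \<phi> :: "'i \<Rightarrow> 'a \<Rightarrow> 'a" and U :: "'k \<Rightarrow> 'a set"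
  assumes A: "finite A" "card A \<ge> 2" and E: "E \<noteq> {}" "\<And>i. i \<in> A \<Longrightarrow> \<phi> i ` E \<subseteq> E"
    and \<delta>: "\<delta> > 0"
    and sep: "\<And>i j x y. i \<in> A \<Longrightarrow> j \<in> A \<Longrightarrow> i \<noteq> j \<Longrightarrow> x \<in> \<phi> i ` E \<Longrightarrow> y \<in> \<phi> j ` E \<Longrightarrow> \<delta> \<le> dist x y"
    and c: "\<And>i. i \<in> A \<Longrightarrow> c i > 0"
    and expand: "\<And>i x y. i \<in> A \<Longrightarrow> x \<in> E \<Longrightarrow> y \<in> E \<Longrightarrow> c i * dist x y \<le> dist (\<phi> i x) (\<phi> i y)"
    and t: "t > 0" "1 \<le> (\<Sum>i\<in>A. c i powr t)"
    and T: "finite T" "E \<subseteq> (\<Union>k\<in>T. U k)" "\<And>k. k \<in> T \<Longrightarrow> bounded (U k)"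
  shows "\<delta> powr t \<le> (\<Sum>k\<in>T. diameter (U k) powr t)"
  using T
\<comment> \<open>The induction is on the number of covering sets and must vary \<open>U\<close>,
  because the step passes to preimages.\<close>
proof (induction "card T" arbitrary: T U rule: less_induct)
  case less
  show ?case
  proof (cases "\<exists>k\<in>T. \<delta> \<le> diameter (U k)")
    case True
    then obtain k where k: "k \<in> T" "\<delta> \<le> diameter (U k)" by blast
    have "\<delta> powr t \<le> diameter (U k) powr t" using k \<delta> t by (intro powr_mono2) auto
    also have "\<dots> \<le> (\<Sum>k\<in>T. diameter (U k) powr t)"
      using k less.prems by (intro member_le_sum) auto
    finally show ?thesis .
  next
    case False
    define S where "S i = {k \<in> T. U k \<inter> \<phi> i ` E \<noteq> {}}" for i
    have S_disj: "S i \<inter> S j = {}" if "i \<in> A" "j \<in> A" "i \<noteq> j" for i j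
    proof (rule ccontr)
      assume "S i \<inter> S j \<noteq> {}"
      then obtain k x y where k: "k \<in> T" "x \<in> U k" "x \<in> \<phi> i ` E" "y \<in> U k" "y \<in> \<phi> j ` E"
        unfolding S_def by blast
      have "\<delta> \<le> dist x y" using sep that k by blast
      also have "\<dots> \<le> diameter (U k)" using less.prems k by (intro diameter_bounded_bound) auto
      finally show False using False k by blast
    qed
    have S_ne: "S i \<noteq> {}" if "i \<in> A" for i
    proof -
      obtain x where "x \<in> E" using E by blast
      then have "\<phi> i x \<in> E" using E(2) that by blast
      then obtain k where "k \<in> T" "\<phi> i x \<in> U k" using less.prems by blast
      then show ?thesis using \<open>x \<in> E\<close> by (auto simp: S_def)
    qed
    \<comment> \<open>Another piece needs covering sets of its own, disjoint from those of piece
      \<open>i\<close>; here \<open>card A \<ge> 2\<close> makes the induction decrease.\<close>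
    have card_S: "card (S i) < card T" if i: "i \<in> A" for i
    proof -
      have "A \<noteq> {i}" using A by auto
      then obtain j where "j \<in> A" "j \<noteq> i" using i by blast
      moreover have "S i \<subseteq> T" "S j \<subseteq> T" by (auto simp: S_def)
      ultimately have "S i \<subset> T" using S_disj[of j i] S_ne[of j] i by blast
      then show ?thesis using less.prems(1) by (rule psubset_card_mono[rotated])
    qed
    have step: "c i powr t * \<delta> powr t \<le> (\<Sum>k\<in>S i. diameter (U k) powr t)" if i: "i \<in> A" for i
    proof -
      define U' where "U' k = {x \<in> E. \<phi> i x \<in> U k}" for k
      have dist_le: "dist x y \<le> diameter (U k) / c i" if "k \<in> T" "x \<in> U' k" "y \<in> U' k" for k x y
      proof -
        have "c i * dist x y \<le> dist (\<phi> i x) (\<phi> i y)" using expand i that by (auto simp: U'_def)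
        also have "\<dots> \<le> diameter (U k)"
          using less.prems that by (intro diameter_bounded_bound) (auto simp: U'_def)
        finally show ?thesis using c[OF i] by (simp add: field_simps)
      qed
      have bdd: "bounded (U' k)" if "k \<in> T" for k
        unfolding bounded_two_points using dist_le that by blast
      have diam: "diameter (U' k) \<le> diameter (U k) / c i" if "k \<in> T" for k
        using dist_le that c[OF i] less.prems by (intro diameter_leI) (auto simp: diameter_ge_0)
      have "\<delta> powr t \<le> (\<Sum>k\<in>S i. diameter (U' k) powr t)"
      proof (rule less.hyps)
        show "card (S i) < card T" by (rule card_S[OF i])
        show "finite (S i)" using less.prems by (auto simp: S_def)
        show "E \<subseteq> (\<Union>k\<in>S i. U' k)"
        proof
          fix x assume x: "x \<in> E"
          then have "\<phi> i x \<in> E" using E i by blast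
          then obtain k where k: "k \<in> T" "\<phi> i x \<in> U k" using less.prems by blast
          then have "k \<in> S i" "x \<in> U' k" using x by (auto simp: S_def U'_def)
          then show "x \<in> (\<Union>k\<in>S i. U' k)" by blast
        qed
      qed (use bdd in \<open>auto simp: S_def\<close>)
      also have "\<dots> \<le> (\<Sum>k\<in>S i. (diameter (U k) / c i) powr t)"
        using diam bdd t by (intro sum_mono powr_mono2) (auto simp: S_def diameter_ge_0)
      also have "\<dots> = (\<Sum>k\<in>S i. diameter (U k) powr t) / c i powr t"
        unfolding sum_divide_distrib using c[OF i] less.prems
        by (intro sum.cong) (auto simp: S_def powr_divide diameter_ge_0)
      finally show ?thesis using c[OF i] by (simp add: field_simps)
    qed
    \<comment> \<open>The weights add up to at least 1, so the shares of the pieces restore the full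
      bound.\<close>
    have "\<delta> powr t \<le> (\<Sum>i\<in>A. c i powr t) * \<delta> powr t"
      using t by (simp add: mult_le_cancel_right1)
    also have "\<dots> = (\<Sum>i\<in>A. c i powr t * \<delta> powr t)" by (rule sum_distrib_right)
    also have "\<dots> \<le> (\<Sum>i\<in>A. \<Sum>k\<in>S i. diameter (U k) powr t)" by (rule sum_mono) (rule step)
    also have "\<dots> = (\<Sum>k\<in>(\<Union>i\<in>A. S i). diameter (U k) powr t)"
      using A less.prems S_disj by (intro sum.UNION_disjoint[symmetric]) (auto simp: S_def)
    also have "\<dots> \<le> (\<Sum>k\<in>T. diameter (U k) powr t)"
      using less.prems by (intro sum_mono2) (auto simp: S_def)
    finally show ?thesis .
  qed
qed

text \<open>Lets the members of a countable cover be made open at arbitrarily small cost, so that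
  compactness yields a finite subcover.\<close>

lemma open_neighbourhood_diameter_powr:
  fixes U :: "'a::metric_space set"
  assumes "bounded U" "t > 0" "e > 0"
  obtains V where "open V" "U \<subseteq> V" "bounded V" "diameter V powr t \<le> diameter U powr t + e"
proof -
  have d: "diameter U \<ge> 0" by (rule diameter_ge_0) fact
  \<comment> \<open>The diameter may be 0, where the power is continuous only for nonnegative bases;
    hence the limit from the right.\<close>
  have nn: "\<forall>\<^sub>F x in at_right (0::real). 0 \<le> diameter U + 2 * x"
    using eventually_at_right_less[of "0::real"] by eventually_elim (use d in auto)
  have "((\<lambda>x. (diameter U + 2 * x) powr t) \<longlongrightarrow> (diameter U + 2 * 0) powr t) (at_right 0)"
    by (rule tendsto_powr') (use assms nn in \<open>auto intro!: tendsto_eq_intros\<close>)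
  then have "\<forall>\<^sub>F x in at_right 0. (diameter U + 2 * x) powr t < diameter U powr t + e"
    by (rule order_tendstoD) (use assms in auto)
  then have "\<forall>\<^sub>F x in at_right 0. (diameter U + 2 * x) powr t < diameter U powr t + e \<and> x > 0"
    using eventually_at_right_less by eventually_elim auto
  then obtain x where x: "(diameter U + 2 * x) powr t < diameter U powr t + e" "x > 0"
    using eventually_happens trivial_limit_at_right_real by blast
  define V where "V = (\<Union>y\<in>U. ball y x)"
  have dist: "dist a b \<le> diameter U + 2 * x" if ab: "a \<in> V" "b \<in> V" for a b
  proof -
    obtain a' b' where *: "a' \<in> U" "b' \<in> U" "dist a' a < x" "dist b' b < x" using ab by (auto simp: V_def)
    have "dist a b \<le> dist a' a + dist a' b' + dist b' b" by metric
    then show ?thesis using * diameter_bounded_bound[OF assms(1), of a' b'] by linarith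
  qed
  have bdd: "bounded V" unfolding bounded_two_points using dist by blast
  have "diameter V \<le> diameter U + 2 * x"
    using dist d x by (intro diameter_leI) auto
  then have "diameter V powr t \<le> (diameter U + 2 * x) powr t"
    using assms bdd by (intro powr_mono2) (auto simp: diameter_ge_0)
  then have "diameter V powr t \<le> diameter U powr t + e" using x by linarith
  moreover have "open V" "U \<subseteq> V" using x by (auto simp: V_def)
  ultimately show ?thesis using that bdd by blast
qed

lemma hausdorff_measure_pos:
  fixes E :: "'a::metric_space set" and \<phi> :: "'i \<Rightarrow> 'a \<Rightarrow> 'a"
  assumes "compact E"
    and A: "finite A" "card A \<ge> 2" and E: "E \<noteq> {}" "\<And>i. i \<in> A \<Longrightarrow> \<phi> i ` E \<subseteq> E"
    and \<delta>: "\<delta> > 0"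
    and sep: "\<And>i j x y. i \<in> A \<Longrightarrow> j \<in> A \<Longrightarrow> i \<noteq> j \<Longrightarrow> x \<in> \<phi> i ` E \<Longrightarrow> y \<in> \<phi> j ` E \<Longrightarrow> \<delta> \<le> dist x y"
    and c: "\<And>i. i \<in> A \<Longrightarrow> c i > 0"
    and expand: "\<And>i x y. i \<in> A \<Longrightarrow> x \<in> E \<Longrightarrow> y \<in> E \<Longrightarrow> c i * dist x y \<le> dist (\<phi> i x) (\<phi> i y)"
    and t: "t > 0" "1 \<le> (\<Sum>i\<in>A. c i powr t)"
  shows "hausdorff_measure t E > 0"
proof -
  have "ennreal (\<delta> powr t) \<le> hausdorff_premeasure 1 t E"
  proof (rule hausdorff_premeasure_greatest)
    fix U :: "nat \<Rightarrow> 'a set"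
    assume U: "E \<subseteq> (\<Union>i. U i)" "\<And>i. bounded (U i)" "\<And>i. diameter (U i) \<le> 1"
    show "ennreal (\<delta> powr t) \<le> (\<Sum>i. diam_pow t (U i))"
    proof (rule ennreal_le_epsilon)
      fix e :: real assume e: "e > 0"
      \<comment> \<open>The cost allowed at index \<open>i\<close> is
        \<open>e * (1/2) ^ Suc i\<close>; these costs sum to \<open>e\<close>.\<close>
      have "\<forall>i. \<exists>V. open V \<and> U i \<subseteq> V \<and> bounded V \<and>
              diameter V powr t \<le> diameter (U i) powr t + e * (1/2) ^ Suc i"
      proof
        fix i
        have "e * (1/2) ^ Suc i > 0" using e by simp
        then show "\<exists>V. open V \<and> U i \<subseteq> V \<and> bounded V \<and>
              diameter V powr t \<le> diameter (U i) powr t + e * (1/2) ^ Suc i"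
          using open_neighbourhood_diameter_powr[OF U(2)[of i] t(1)] by metis
      qed
      then obtain V where V: "\<And>i. open (V i)" "\<And>i. U i \<subseteq> V i" "\<And>i. bounded (V i)"
         "\<And>i. diameter (V i) powr t \<le> diameter (U i) powr t + e * (1/2) ^ Suc i"
        by metis
      have cover: "E \<subseteq> (\<Union>i\<in>UNIV. V i)" using U(1) V(2) by blast
      obtain T where T: "finite T" "E \<subseteq> (\<Union>i\<in>T. V i)"
        using compactE_image[OF assms(1) V(1) cover] by metis
      have "\<delta> powr t \<le> (\<Sum>k\<in>T. diameter (V k) powr t)"
        by (rule sum_diameter_powr_ge[OF A E \<delta> sep c expand t T V(3)])
      also have "\<dots> \<le> (\<Sum>k\<in>T. diameter (U k) powr t + e * (1/2) ^ Suc k)"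
        by (rule sum_mono) (rule V)
      also have "\<dots> = (\<Sum>k\<in>T. diameter (U k) powr t) + (\<Sum>k\<in>T. e * (1/2) ^ Suc k)"
        by (rule sum.distrib)
      also have "(\<Sum>k\<in>T. e * (1/2) ^ Suc k) \<le> (\<Sum>k. e * (1/2) ^ Suc k)"
        using e sums_mult[OF power_half_series, of e] T
        by (intro sum_le_suminf) (auto dest: sums_summable)
      also have "(\<Sum>k. e * (1/2) ^ Suc k) = e"
        using sums_mult[OF power_half_series, of e] by (simp add: sums_iff)
      finally have "\<delta> powr t \<le> (\<Sum>k\<in>T. diameter (U k) powr t) + e" by simp
      then have "ennreal (\<delta> powr t) \<le> ennreal ((\<Sum>k\<in>T. diameter (U k) powr t) + e)"
        by (rule ennreal_leI)
      also have "\<dots> = (\<Sum>k\<in>T. diam_pow t (U k)) + ennreal e"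
        using e t by (simp add: ennreal_plus sum_nonneg diam_pow_eq sum_ennreal)
      also have "\<dots> \<le> (\<Sum>i. diam_pow t (U i)) + ennreal e"
        using T by (intro add_right_mono sum_le_suminf) auto
      finally show "ennreal (\<delta> powr t) \<le> (\<Sum>i. diam_pow t (U i)) + ennreal e" .
    qed
  qed
  moreover have "0 < ennreal (\<delta> powr t)" using \<delta> by simp
  ultimately show ?thesis using hausdorff_premeasure_le_measure[of 1 t E] by (meson order_less_le_trans zero_less_one)
qed

section \<open>Uniformly quasi-self-similar Cantor sets\<close>

lemma separate_compact_family:
  fixes A :: "'i \<Rightarrow> 'a::heine_borel set"
  assumes "finite I" "disjoint_family_on A I" "\<And>i. i \<in> I \<Longrightarrow> compact (A i)"
  obtains \<delta> where "\<delta> > 0"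
    "\<And>i j x y. i \<in> I \<Longrightarrow> j \<in> I \<Longrightarrow> i \<noteq> j \<Longrightarrow> x \<in> A i \<Longrightarrow> y \<in> A j \<Longrightarrow> \<delta> \<le> dist x y"
proof -
  have "\<exists>d>0. \<forall>x\<in>A i. \<forall>y\<in>A j. d \<le> dist x y" if "i \<in> I" "j \<in> I" "i \<noteq> j" for i j
    using assms that by (intro separate_compact_closed compact_imp_closed) (auto simp: disjoint_family_on_def)
  then obtain d where d: "\<And>i j. i \<in> I \<Longrightarrow> j \<in> I \<Longrightarrow> i \<noteq> j \<Longrightarrow> d i j > 0 \<and> (\<forall>x\<in>A i. \<forall>y\<in>A j. d i j \<le> dist x y)"
    by metis
  define P where "P = {p \<in> I \<times> I. fst p \<noteq> snd p}"
  \<comment> \<open>The extra 1 keeps the minimum defined when there are no two distinct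
    indices.\<close>
  define \<delta> where "\<delta> = Min (insert 1 ((\<lambda>p. d (fst p) (snd p)) ` P))"
  have fin: "finite P" using assms(1) by (auto simp: P_def)
  show ?thesis
  proof (rule that[of \<delta>])
    show "\<delta> > 0" unfolding \<delta>_def using fin d by (subst Min_gr_iff) (auto simp: P_def)
    fix i j x y assume *: "i \<in> I" "j \<in> I" "i \<noteq> j" "x \<in> A i" "y \<in> A j"
    have "\<delta> \<le> d i j" unfolding \<delta>_def using fin * by (intro Min_le) (auto simp: P_def image_iff intro!: bexI[of _ "(i,j)"])
    then show "\<delta> \<le> dist x y" using d * by fastforce
  qed
qed

text \<open>The first letter is the outermost map, so extending a word on the right passes to a
  smaller cylinder.\<close>

primrec word_map :: "(nat \<Rightarrow> 'a \<Rightarrow> 'a) \<Rightarrow> nat list \<Rightarrow> 'a \<Rightarrow> 'a" where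
  "word_map f [] x = x"
| "word_map f (i # w) x = f i (word_map f w x)"

lemma word_map_append: "word_map f (u @ w) x = word_map f u (word_map f w x)"
  by (induction u) auto

text \<open>
  The number \<open>r w\<close> is the contraction ratio of the map of the word \<open>w\<close> up to the factor \<open>K\<close>, which
  does not depend on \<open>w\<close>.
\<close>

locale cantor_system =
  fixes E :: "'a::heine_borel set" and N :: nat and f :: "nat \<Rightarrow> 'a \<Rightarrow> 'a"
    and r :: "nat list \<Rightarrow> real" and K L :: real
  assumes compact_E: "compact E" and E_ne: "E \<noteq> {}" and N_ge_2: "2 \<le> N"
    and E_eq: "E = (\<Union>i\<in>{1..N}. f i ` E)"
    and disj: "disjoint_family_on (\<lambda>i. f i ` E) {1..N}"
    and L_pos: "0 < L" and L_less: "L < 1"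
    and contraction: "\<And>i x y. i \<in> {1..N} \<Longrightarrow> x \<in> E \<Longrightarrow> y \<in> E \<Longrightarrow> dist (f i x) (f i y) \<le> L * dist x y"
    and K_ge_1: "K \<ge> 1"
    and r_pos: "\<And>w. w \<in> lists {1..N} \<Longrightarrow> r w > 0"
    and upper: "\<And>w x y. w \<in> lists {1..N} \<Longrightarrow> x \<in> E \<Longrightarrow> y \<in> E \<Longrightarrow>
                  dist (word_map f w x) (word_map f w y) \<le> K * r w * dist x y"
    and lower: "\<And>w x y. w \<in> lists {1..N} \<Longrightarrow> x \<in> E \<Longrightarrow> y \<in> E \<Longrightarrow>
                  r w * dist x y \<le> K * dist (word_map f w x) (word_map f w y)"
begin

section \<open>Words, cylinders and the distances inside and between them\<close>

definition words :: "nat \<Rightarrow> nat list set" where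
  "words q = {w \<in> lists {1..N}. length w = q}"

definition cyl :: "nat list \<Rightarrow> 'a set" where
  "cyl w = word_map f w ` E"

lemma K_pos: "K > 0" using K_ge_1 by simp

lemma wordsD: "w \<in> words q \<Longrightarrow> w \<in> lists {1..N}" "w \<in> words q \<Longrightarrow> length w = q"
  by (auto simp: words_def)

lemma words_0 [simp]: "words 0 = {[]}"
  by (auto simp: words_def)

lemma words_Suc: "words (Suc q) = (\<lambda>(i, w). i # w) ` ({1..N} \<times> words q)"
  by (fastforce simp: words_def length_Suc_conv image_iff)

lemma finite_words: "finite (words q)"
  by (induction q) (auto simp: words_Suc)

lemma card_words: "card (words q) = N ^ q"
proof (induction q)
  case (Suc q)
  have "inj_on (\<lambda>(i, w). i # w) ({1..N} \<times> words q)" by (auto intro: inj_onI)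
  then show ?case by (simp add: words_Suc card_image card_cartesian_product Suc)
qed auto

lemma f_in_E: "i \<in> {1..N} \<Longrightarrow> x \<in> E \<Longrightarrow> f i x \<in> E"
  using E_eq by blast

lemma word_map_in_E: "w \<in> lists {1..N} \<Longrightarrow> x \<in> E \<Longrightarrow> word_map f w x \<in> E"
  by (induction w) (auto intro!: f_in_E)

lemma cyl_Nil [simp]: "cyl [] = E"
  by (auto simp: cyl_def)

lemma cyl_subset_E: "w \<in> lists {1..N} \<Longrightarrow> cyl w \<subseteq> E"
  using word_map_in_E by (auto simp: cyl_def)

lemma cyl_append: "cyl (u @ w) = word_map f u ` cyl w"
  by (auto simp: cyl_def word_map_append image_image)

lemma cyl_Cons: "cyl (i # w) = f i ` cyl w"
  by (auto simp: cyl_def image_image)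

lemma cyl_Cons_subset: "w \<in> lists {1..N} \<Longrightarrow> cyl (i # w) \<subseteq> cyl [i]"
  using cyl_subset_E by (auto simp: cyl_Cons)

lemma cyl_ne: "cyl w \<noteq> {}"
  using E_ne by (auto simp: cyl_def)

lemma inj_word_map: "w \<in> lists {1..N} \<Longrightarrow> inj_on (word_map f w) E"
  using lower r_pos by (fastforce intro!: inj_onI simp: mult_le_0_iff)

lemma E_eq_words: "E = (\<Union>w\<in>words q. cyl w)"
proof (induction q)
  case (Suc q)
  have "E = (\<Union>i\<in>{1..N}. f i ` E)" by (rule E_eq)
  also have "\<dots> = (\<Union>i\<in>{1..N}. \<Union>w\<in>words q. f i ` cyl w)" by (subst Suc) blast
  also have "\<dots> = (\<Union>w\<in>words (Suc q). cyl w)" by (auto simp: words_Suc cyl_Cons simp del: atLeastAtMost_iff One_nat_def) blast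
  finally show ?case .
qed simp

lemma E_in_words:
  assumes "x \<in> E" obtains w where "w \<in> words q" "x \<in> cyl w"
  using assms E_eq_words[of q] by blast

lemma cyl_eq_words: "cyl u = (\<Union>w\<in>words q. cyl (u @ w))"
  by (subst (1) cyl_def, subst E_eq_words[of q]) (auto simp: cyl_append)

lemma continuous_word_map: "w \<in> lists {1..N} \<Longrightarrow> continuous_on E (word_map f w)"
proof (rule continuous_onI)
  fix x e assume w: "w \<in> lists {1..N}" and x: "x \<in> E" and e: "0 < (e::real)"
  have C: "K * r w > 0" using K_pos r_pos[OF w] by simp
  show "\<exists>d>0. \<forall>x'\<in>E. dist x' x < d \<longrightarrow> dist (word_map f w x') (word_map f w x) \<le> e"
  proof (intro exI[of _ "e / (K * r w)"] conjI ballI impI)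
    fix x' assume x': "x' \<in> E" "dist x' x < e / (K * r w)"
    then have "K * r w * dist x' x < e" using C by (simp add: field_simps)
    then show "dist (word_map f w x') (word_map f w x) \<le> e" using upper[OF w x'(1) x] by linarith
  qed (use C e in auto)
qed

lemma compact_cyl: "w \<in> lists {1..N} \<Longrightarrow> compact (cyl w)"
  unfolding cyl_def by (intro compact_continuous_image continuous_word_map compact_E)

lemma disj_words: "disjoint_family_on cyl (words q)"
proof (induction q)
  case 0
  then show ?case by (auto simp: disjoint_family_on_def)
next
  case (Suc q)
  have "cyl (i # w) \<inter> cyl (j # v) = {}"
    if *: "i \<in> {1..N}" "j \<in> {1..N}" "w \<in> words q" "v \<in> words q" "i # w \<noteq> j # v" for i j w v
  proof (cases "i = j")
    case False
    have "cyl (i # w) \<subseteq> f i ` E" "cyl (j # v) \<subseteq> f j ` E"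
      unfolding cyl_Cons using * cyl_subset_E wordsD(1) by (intro image_mono; blast)+
    moreover have "f i ` E \<inter> f j ` E = {}" using disj * False by (auto simp: disjoint_family_on_def)
    ultimately show ?thesis by blast
  next
    case True
    have "inj_on (f i) E" using inj_word_map[of "[i]"] * by (simp add: inj_on_def)
    moreover have "cyl w \<inter> cyl v = {}" using Suc * True by (auto simp: disjoint_family_on_def)
    moreover have "cyl w \<subseteq> E" "cyl v \<subseteq> E" using * cyl_subset_E wordsD by auto
    ultimately show ?thesis using True unfolding cyl_Cons
      by (metis image_empty inj_on_image_Int)
  qed
  then show ?case by (auto simp: disjoint_family_on_def words_Suc)
qed

lemma separated_words:
  obtains \<delta> where "\<delta> > 0"
    "\<And>v w x y. v \<in> words q \<Longrightarrow> w \<in> words q \<Longrightarrow> v \<noteq> w \<Longrightarrow> x \<in> cyl v \<Longrightarrow> y \<in> cyl w \<Longrightarrow> \<delta> \<le> dist x y"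
  using separate_compact_family[OF finite_words disj_words] compact_cyl wordsD(1) by metis

lemma dist_le_diameter: "x \<in> E \<Longrightarrow> y \<in> E \<Longrightarrow> dist x y \<le> diameter E"
  by (intro diameter_bounded_bound compact_imp_bounded compact_E)

lemma diameter_nonneg: "0 \<le> diameter E"
  by (intro diameter_ge_0 compact_imp_bounded compact_E)

lemma word_map_contraction:
  assumes "w \<in> lists {1..N}" "x \<in> E" "y \<in> E"
  shows "dist (word_map f w x) (word_map f w y) \<le> L ^ length w * dist x y"
  using assms
proof (induction w)
  case (Cons i w)
  have "dist (word_map f (i # w) x) (word_map f (i # w) y) \<le> L * dist (word_map f w x) (word_map f w y)"
    using Cons by (auto intro!: contraction word_map_in_E)
  also have "\<dots> \<le> L * (L ^ length w * dist x y)"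
    using Cons L_pos by (intro mult_left_mono) auto
  finally show ?case by simp
qed auto

lemma dist_cyl_le:
  assumes "w \<in> lists {1..N}" "x \<in> cyl w" "y \<in> cyl w"
  shows "dist x y \<le> L ^ length w * diameter E"
proof -
  obtain x' y' where *: "x = word_map f w x'" "y = word_map f w y'" "x' \<in> E" "y' \<in> E"
    using assms by (auto simp: cyl_def)
  then have "dist x y \<le> L ^ length w * dist x' y'" using word_map_contraction assms by simp
  also have "\<dots> \<le> L ^ length w * diameter E"
    using * L_pos by (intro mult_left_mono dist_le_diameter) auto
  finally show ?thesis .
qed

lemma diameter_cyl_le_power:
  "w \<in> lists {1..N} \<Longrightarrow> diameter (cyl w) \<le> L ^ length w * diameter E"
  using dist_cyl_le L_pos diameter_nonneg by (intro diameter_leI) auto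

lemma diameter_cyl_le: "w \<in> lists {1..N} \<Longrightarrow> diameter (cyl w) \<le> K * r w * diameter E"
proof (rule diameter_leI)
  assume w: "w \<in> lists {1..N}"
  have C: "K * r w \<ge> 0" using K_pos r_pos[OF w] by simp
  then show "0 \<le> K * r w * diameter E" using diameter_nonneg by simp
  fix x y assume "x \<in> cyl w" "y \<in> cyl w"
  then obtain x' y' where *: "x = word_map f w x'" "y = word_map f w y'" "x' \<in> E" "y' \<in> E"
    by (auto simp: cyl_def)
  then have "dist x y \<le> K * r w * dist x' y'" using upper w by simp
  also have "\<dots> \<le> K * r w * diameter E"
    using * C by (intro mult_left_mono dist_le_diameter) auto
  finally show "dist x y \<le> K * r w * diameter E" .
qed

lemma power_L_tendsto: "(\<lambda>q. L ^ Suc q * diameter E) \<longlonglongrightarrow> 0"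
proof -
  have "(\<lambda>n. L ^ Suc n * diameter E) \<longlonglongrightarrow> 0 * diameter E"
    using L_pos L_less by (intro tendsto_mult tendsto_const LIMSEQ_Suc LIMSEQ_realpow_zero) auto
  then show ?thesis by simp
qed

lemma power_L_small:
  assumes "e > 0" obtains n where "L ^ Suc n * diameter E < e"
  using order_tendstoD(2)[OF power_L_tendsto assms] that eventually_happens by force

lemma dense_if_meets_cyls:
  assumes "\<And>w. w \<in> words q \<Longrightarrow> A \<inter> cyl w \<noteq> {}" "x \<in> E"
  shows "\<exists>x'\<in>A. dist x x' \<le> L ^ q * diameter E"
proof -
  obtain w where w: "w \<in> words q" "x \<in> cyl w" using E_in_words assms(2) by blast
  then obtain x' where "x' \<in> A" "x' \<in> cyl w" using assms(1) by blast
  then show ?thesis using dist_cyl_le[of w x x'] w wordsD[OF w(1)] by auto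
qed

text \<open>Strictness leaves room to raise the exponent: the sum still exceeds 1 at some
  \<open>t > s\<close>, and the mass distribution estimate with lower ratios \<open>r w / K\<close>
  makes the \<open>t\<close>-dimensional measure positive.\<close>

lemma hausdorff_dim_gt:
  assumes "s \<ge> 0" "(\<Sum>w\<in>words (Suc n). (r w / K) powr s) > 1"
  shows "ereal s < hausdorff_dim E"
proof -
  have c_pos: "r w / K > 0" if "w \<in> words (Suc n)" for w
    using r_pos K_pos wordsD that by simp
  have "((\<lambda>t. \<Sum>w\<in>words (Suc n). (r w / K) powr t) \<longlongrightarrow> (\<Sum>w\<in>words (Suc n). (r w / K) powr s)) (at_right s)"
    by (intro tendsto_intros) (use c_pos in force)
  then have "\<forall>\<^sub>F t in at_right s. (\<Sum>w\<in>words (Suc n). (r w / K) powr t) > 1"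
    using assms by (intro order_tendstoD) auto
  then have "\<forall>\<^sub>F t in at_right s. (\<Sum>w\<in>words (Suc n). (r w / K) powr t) > 1 \<and> t > s"
    using eventually_at_right_less by eventually_elim auto
  then obtain t where t: "(\<Sum>w\<in>words (Suc n). (r w / K) powr t) > 1" "t > s"
    using eventually_happens trivial_limit_at_right_real by blast
  obtain \<delta> where \<delta>: "\<delta> > 0"
    "\<And>v w x y. v \<in> words (Suc n) \<Longrightarrow> w \<in> words (Suc n) \<Longrightarrow> v \<noteq> w \<Longrightarrow> x \<in> cyl v \<Longrightarrow> y \<in> cyl w \<Longrightarrow> \<delta> \<le> dist x y"
    using separated_words[of "Suc n"] by metis
  have "hausdorff_measure t E > 0"
  proof (rule hausdorff_measure_pos[where A = "words (Suc n)" and \<phi> = "word_map f" and c = "\<lambda>w. r w / K"])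
    have "2 * 1 \<le> N * N ^ n" using N_ge_2 by (intro mult_le_mono) auto
    then show "2 \<le> card (words (Suc n))" unfolding card_words by simp
    show "word_map f w ` E \<subseteq> E" if "w \<in> words (Suc n)" for w
      using that word_map_in_E wordsD by blast
    show "r w / K * dist x y \<le> dist (word_map f w x) (word_map f w y)"
      if "w \<in> words (Suc n)" "x \<in> E" "y \<in> E" for w x y
      using lower[of w x y] that wordsD K_pos by (simp add: field_simps)
  qed (use compact_E E_ne finite_words \<delta> c_pos t assms in \<open>auto simp: cyl_def\<close>)
  then have "ereal t \<le> hausdorff_dim E" by (rule hausdorff_dim_ge)
  moreover have "ereal s < ereal t" using t by simp
  ultimately show ?thesis by (rule order_less_le_trans[rotated])
qed

text \<open>At exponent 0 the cylinder sum counts words, and there are at least two of length 1, so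
  the strict dimension bound excludes 0.\<close>

lemma hausdorff_dim_pos:
  assumes "hausdorff_dim E = ereal s"
  shows "s > 0"
proof -
  have "0 \<le> hausdorff_dim E" unfolding hausdorff_dim_def by (rule INF_greatest) auto
  then have "s \<ge> 0" using assms by simp
  moreover have "s \<noteq> 0"
  proof
    assume "s = 0"
    have "(\<Sum>w\<in>words (Suc 0). (r w / K) powr 0) = (\<Sum>w\<in>words (Suc 0). 1)"
      using r_pos K_pos wordsD by (intro sum.cong) (force, simp add: less_imp_neq[symmetric])
    also have "\<dots> > 1" using N_ge_2 by (simp add: card_words)
    finally have "ereal 0 < hausdorff_dim E" by (intro hausdorff_dim_gt) auto
    then show False using assms \<open>s = 0\<close> by simp
  qed
  ultimately show ?thesis by simp
qed

text \<open>At the dimension itself the sums of \<open>(r w / K) powr s\<close> cannot exceed 1 at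
  any level, so the covers by cylinders have bounded cost at every scale.\<close>

lemma hausdorff_measure_finite:
  assumes dim: "hausdorff_dim E = ereal s"
  shows "hausdorff_measure s E < \<infinity>"
proof -
  have s: "s > 0" by (rule hausdorff_dim_pos) fact
  \<comment> \<open>One factor \<open>K\<close> comes from the diameter bound for cylinders, the
    other from rewriting \<open>r w\<close> through the lower ratio \<open>r w / K\<close>.\<close>
  define M where "M = (K * K * diameter E) powr s"
  have "hausdorff_measure s E \<le> ennreal M"
  proof (rule hausdorff_measure_least)
    fix \<delta> :: real assume \<delta>: "\<delta> > 0"
    obtain n where n: "L ^ Suc n * diameter E < \<delta>" using power_L_small[OF \<delta>] by blast
    have "hausdorff_premeasure \<delta> s E \<le> (\<Sum>w\<in>words (Suc n). hausdorff_premeasure \<delta> s (cyl w))"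
      using hausdorff_premeasure_UN_finite[OF finite_words, of \<delta> s cyl "Suc n"] \<delta>
      by (simp flip: E_eq_words)
    also have "\<dots> \<le> (\<Sum>w\<in>words (Suc n). diam_pow s (cyl w))"
    proof (intro sum_mono hausdorff_premeasure_le_diam_pow)
      fix w assume w: "w \<in> words (Suc n)"
      show "bounded (cyl w)" using w compact_cyl compact_imp_bounded wordsD by blast
      show "diameter (cyl w) \<le> \<delta>" using w n diameter_cyl_le_power[of w] wordsD[OF w] by simp
    qed (use \<delta> in auto)
    also have "\<dots> = ennreal (\<Sum>w\<in>words (Suc n). diameter (cyl w) powr s)"
      using s by (simp add: diam_pow_eq sum_ennreal)
    also have "\<dots> \<le> ennreal M"
    proof (rule ennreal_leI)
      have "(\<Sum>w\<in>words (Suc n). diameter (cyl w) powr s) \<le> (\<Sum>w\<in>words (Suc n). M * (r w / K) powr s)"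
      proof (rule sum_mono)
        fix w assume w: "w \<in> words (Suc n)"
        note w' = wordsD(1)[OF w]
        have "diameter (cyl w) powr s \<le> (K * r w * diameter E) powr s"
          using s w' compact_cyl compact_imp_bounded
          by (intro powr_mono2 diameter_cyl_le) (auto intro!: diameter_ge_0)
        also have "K * r w * diameter E = K * K * diameter E * (r w / K)"
          using K_pos by simp
        also have "\<dots> powr s = M * (r w / K) powr s"
          unfolding M_def by (rule powr_mult)
        finally show "diameter (cyl w) powr s \<le> M * (r w / K) powr s" .
      qed
      also have "\<dots> = M * (\<Sum>w\<in>words (Suc n). (r w / K) powr s)" by (simp add: sum_distrib_left)
      also have "\<dots> \<le> M * 1"
        using hausdorff_dim_gt[of s n] dim s by (intro mult_left_mono) (auto simp: M_def not_less[symmetric])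
      finally show "(\<Sum>w\<in>words (Suc n). diameter (cyl w) powr s) \<le> M" by simp
    qed
    finally show "hausdorff_premeasure \<delta> s E \<le> ennreal M" .
  qed
  then show ?thesis using order_le_less_trans by fastforce
qed

section \<open>Measures of cylinders and of images under word maps\<close>

lemma hausdorff_measure_le_word_image:
  assumes s: "s > 0" and u: "u \<in> lists {1..N}" and X: "X \<subseteq> E"
  shows "hausdorff_measure s X \<le> ennreal ((K / r u) powr s) * hausdorff_measure s (word_map f u ` X)"
proof -
  define g where "g = inv_into E (word_map f u)"
  have g: "g (word_map f u x) = x" if "x \<in> X" for x
    unfolding g_def using inj_word_map[OF u] X that by (intro inv_into_f_f) auto
  have "hausdorff_measure s (g ` word_map f u ` X) \<le> ennreal ((K / r u) powr s) * hausdorff_measure s (word_map f u ` X)"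
  proof (rule hausdorff_measure_lipschitz_image[OF s])
    show "0 < K / r u" using K_pos r_pos[OF u] by simp
    fix x y assume "x \<in> word_map f u ` X" "y \<in> word_map f u ` X"
    then show "dist (g x) (g y) \<le> K / r u * dist x y"
      using lower[OF u] X g r_pos[OF u] by (auto simp: field_simps subset_iff)
  qed
  also have "g ` word_map f u ` X = X" using g by (force simp: image_image)
  finally show ?thesis .
qed

lemma hausdorff_measure_word_image_le:
  assumes s: "s > 0" and u: "u \<in> lists {1..N}" and X: "X \<subseteq> E"
  shows "hausdorff_measure s (word_map f u ` X) \<le> ennreal ((K * r u) powr s) * hausdorff_measure s X"
  using upper[OF u] X K_pos r_pos[OF u] by (intro hausdorff_measure_lipschitz_image s) auto

text \<open>The constant is independent of \<open>u\<close>: the upper bound for the image under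
  \<open>u\<close> and the lower bound for that of the subcylinder cancel \<open>r u\<close>,
  leaving only the ratios of the finitely many \<open>w\<close>.\<close>

lemma hausdorff_measure_cyl_append:
  assumes s: "s > 0"
  obtains C where "C \<ge> 1" "\<And>u w. u \<in> lists {1..N} \<Longrightarrow> w \<in> words q \<Longrightarrow>
     hausdorff_measure s (cyl u) \<le> ennreal C * hausdorff_measure s (cyl (u @ w))"
proof -
  \<comment> \<open>The sum stands in for a maximum over the words of length \<open>q\<close>; the 1
    secures \<open>C \<ge> 1\<close>.\<close>
  define C where "C = 1 + (\<Sum>w\<in>words q. (K * K * K / r w) powr s)"
  show ?thesis
  proof (rule that[of C])
    show "C \<ge> 1" by (auto simp: C_def intro!: sum_nonneg)
    fix u w assume u: "u \<in> lists {1..N}" and w: "w \<in> words q"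
    note w' = wordsD(1)[OF w]
    have "hausdorff_measure s (cyl u) \<le> ennreal ((K * r u) powr s) * hausdorff_measure s E"
      unfolding cyl_def by (rule hausdorff_measure_word_image_le[OF s u]) simp
    also have "hausdorff_measure s E \<le> ennreal ((K / r w) powr s) * hausdorff_measure s (cyl w)"
      unfolding cyl_def by (rule hausdorff_measure_le_word_image[OF s w']) simp
    also have "hausdorff_measure s (cyl w) \<le> ennreal ((K / r u) powr s) * hausdorff_measure s (cyl (u @ w))"
      unfolding cyl_append by (rule hausdorff_measure_le_word_image[OF s u cyl_subset_E[OF w']])
    also have "ennreal ((K * r u) powr s) * (ennreal ((K / r w) powr s) * (ennreal ((K / r u) powr s) * hausdorff_measure s (cyl (u @ w))))
       = ennreal ((K * r u) powr s * ((K / r w) powr s * (K / r u) powr s)) * hausdorff_measure s (cyl (u @ w))"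
      by (simp add: ennreal_mult mult_ac)
    also have "(K * r u) powr s * ((K / r w) powr s * (K / r u) powr s) = (K * K * K / r w) powr s"
      using K_pos r_pos[OF u] r_pos[OF w'] by (simp add: mult.assoc flip: powr_mult)
    also have "ennreal ((K * K * K / r w) powr s) * hausdorff_measure s (cyl (u @ w)) \<le> ennreal C * hausdorff_measure s (cyl (u @ w))"
    proof (intro mult_right_mono ennreal_leI)
      have "(K * K * K / r w) powr s \<le> (\<Sum>w\<in>words q. (K * K * K / r w) powr s)"
        using w finite_words by (intro member_le_sum) auto
      then show "(K * K * K / r w) powr s \<le> C" by (simp add: C_def)
    qed auto
    finally show "hausdorff_measure s (cyl u) \<le> ennreal C * hausdorff_measure s (cyl (u @ w))"
      by (simp add: mult_left_mono)
  qed
qed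

text \<open>
  This replaces the density theorem: if \<open>A\<close> missed a subcylinder \<open>q\<close> levels down in every cylinder, then
  each \<open>q\<close> levels would cost it a fixed proportion of the measure.
\<close>

lemma dense_in_some_cyl:
  assumes s: "s > 0" and fin: "hausdorff_measure s E < \<infinity>"
    and A: "A \<subseteq> E" "hausdorff_measure s A > 0"
  obtains u where "u \<in> lists {1..N}" "\<And>w. w \<in> words q \<Longrightarrow> A \<inter> cyl (u @ w) \<noteq> {}"
proof (rule ccontr)
  assume "\<not> thesis"
  with that have miss: "\<exists>w\<in>words q. A \<inter> cyl (u @ w) = {}" if "u \<in> lists {1..N}" for u
    using \<open>u \<in> _\<close> by metis
  obtain C where C: "C \<ge> 1" "\<And>u w. u \<in> lists {1..N} \<Longrightarrow> w \<in> words q \<Longrightarrow>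
     hausdorff_measure s (cyl u) \<le> ennreal C * hausdorff_measure s (cyl (u @ w))"
    using hausdorff_measure_cyl_append[OF s] by metis
  define m where "m X = enn2real (hausdorff_measure s X)" for X :: "'a set"
  have H: "hausdorff_measure s X = ennreal (m X)" if "X \<subseteq> E" for X
  proof -
    have "hausdorff_measure s X < \<infinity>" using hausdorff_measure_mono[OF that] fin by (rule order_le_less_trans)
    then show ?thesis by (simp add: m_def)
  qed
  have m_nn: "m X \<ge> 0" for X by (simp add: m_def)
  have cyl_E: "cyl (u @ w) \<subseteq> E" if "u \<in> lists {1..N}" "w \<in> words q" for u w
    using that wordsD(1) by (intro cyl_subset_E) auto
  \<comment> \<open>A missed subcylinder carries at least the share \<open>1 / C\<close> of the
    measure of its ancestor.\<close>
  define \<theta> where "\<theta> = 1 - 1 / C"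
  have \<theta>: "0 \<le> \<theta>" "\<theta> < 1" using C(1) by (auto simp: \<theta>_def)
  have main: "m (A \<inter> cyl u) \<le> \<theta> ^ k * m (cyl u)" if "u \<in> lists {1..N}" for u k
    using that
  proof (induction k arbitrary: u)
    case 0
    have "ennreal (m (A \<inter> cyl u)) \<le> ennreal (m (cyl u))"
      using 0 cyl_subset_E A by (subst (1 2) H[symmetric]) (auto intro!: hausdorff_measure_mono)
    then show ?case by (simp add: m_nn)
  next
    case (Suc k)
    obtain w0 where w0: "w0 \<in> words q" "A \<inter> cyl (u @ w0) = {}" using miss Suc.prems by blast
    have "ennreal (m (A \<inter> cyl u)) = hausdorff_measure s (\<Union>w\<in>words q. A \<inter> cyl (u @ w))"
      using A by (subst H[symmetric]) (auto simp: cyl_eq_words[of u q])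
    also have "\<dots> \<le> (\<Sum>w\<in>words q. hausdorff_measure s (A \<inter> cyl (u @ w)))"
      by (rule hausdorff_measure_UN_finite_le[OF finite_words])
    also have "\<dots> = (\<Sum>w\<in>words q. ennreal (m (A \<inter> cyl (u @ w))))"
      using A by (intro sum.cong H) auto
    also have "\<dots> = ennreal (\<Sum>w\<in>words q. m (A \<inter> cyl (u @ w)))"
      by (rule sum_ennreal) (rule m_nn)
    finally have 1: "m (A \<inter> cyl u) \<le> (\<Sum>w\<in>words q. m (A \<inter> cyl (u @ w)))"
      by (simp add: sum_nonneg m_nn)
    have "ennreal (\<Sum>w\<in>words q. m (cyl (u @ w))) = (\<Sum>w\<in>words q. hausdorff_measure s (cyl (u @ w)))"
      using cyl_E Suc.prems by (subst sum_ennreal[symmetric]) (auto simp: m_nn H intro!: sum.cong)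
    also have "\<dots> \<le> hausdorff_measure s (\<Union>w\<in>words q. cyl (u @ w))"
    proof (rule hausdorff_measure_UN_compact[OF finite_words])
      show "disjoint_family_on (\<lambda>w. cyl (u @ w)) (words q)"
        using disj_words[of "length u + q"] Suc.prems
        unfolding disjoint_family_on_def words_def by auto
      show "compact (cyl (u @ w))" if "w \<in> words q" for w
        using that Suc.prems wordsD by (intro compact_cyl) auto
    qed
    also have "\<dots> = ennreal (m (cyl u))"
      using Suc.prems H[OF cyl_subset_E] by (simp flip: cyl_eq_words)
    finally have 2: "(\<Sum>w\<in>words q. m (cyl (u @ w))) \<le> m (cyl u)" by (simp add: m_nn)
    have "ennreal (m (cyl u)) \<le> ennreal (C * m (cyl (u @ w0)))"
      using C(2)[OF Suc.prems w0(1)] H[OF cyl_subset_E[OF Suc.prems]] H[OF cyl_E[OF Suc.prems w0(1)]] C(1) m_nn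
      by (simp add: ennreal_mult)
    then have "m (cyl u) \<le> C * m (cyl (u @ w0))" using C(1) m_nn by (simp add: ennreal_le_iff)
    then have 3: "m (cyl u) / C \<le> m (cyl (u @ w0))" using C(1) by (simp add: field_simps)
    have "m {} = 0" by (simp add: m_def)
    then have "(\<Sum>w\<in>words q. m (A \<inter> cyl (u @ w))) = (\<Sum>w\<in>words q - {w0}. m (A \<inter> cyl (u @ w)))"
      using w0 by (simp add: sum.remove[OF finite_words w0(1)])
    also have "\<dots> \<le> (\<Sum>w\<in>words q - {w0}. \<theta> ^ k * m (cyl (u @ w)))"
      using Suc.prems wordsD by (intro sum_mono Suc.IH) auto
    also have "\<dots> = \<theta> ^ k * ((\<Sum>w\<in>words q. m (cyl (u @ w))) - m (cyl (u @ w0)))"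
      by (simp add: sum.remove[OF finite_words w0(1)] flip: sum_distrib_left)
    also have "\<dots> \<le> \<theta> ^ k * (m (cyl u) - m (cyl u) / C)"
      using 2 3 \<theta> by (intro mult_left_mono) auto
    also have "\<dots> = \<theta> ^ Suc k * m (cyl u)" by (simp add: \<theta>_def algebra_simps)
    finally show ?case using 1 by linarith
  qed
  \<comment> \<open>With \<open>u = []\<close> the factor \<open>\<theta> ^ k\<close> bounds the
    measure of all of \<open>A\<close>, for every \<open>k\<close>.\<close>
  have "(\<lambda>k. \<theta> ^ k * m E) \<longlonglongrightarrow> 0 * m E"
    using \<theta> by (intro tendsto_mult tendsto_const LIMSEQ_realpow_zero)
  then have "m A \<le> 0"
    using main[of "[]"] A(1) by (intro LIMSEQ_le_const) (auto simp: Int_absorb2)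
  then have "hausdorff_measure s A = 0" using H[OF A(1)] m_nn[of A] by simp
  then show False using A(2) by simp
qed

end

section \<open>Bilipschitz relations\<close>

text \<open>The two bounds force such a relation to be the graph of an injective partial map, with
  \<open>Domain\<close> and \<open>Range\<close> as source and image. As a relation it can be
  reversed, restricted, pulled back and passed to limits without choosing functions.\<close>

definition bilip_rel :: "real \<Rightarrow> ('a::metric_space \<times> 'b::metric_space) set \<Rightarrow> bool" where
  "bilip_rel C R \<longleftrightarrow> C > 0 \<and> (\<forall>x y x' y'. (x, y) \<in> R \<longrightarrow> (x', y') \<in> R \<longrightarrow>
      dist x x' \<le> C * dist y y' \<and> dist y y' \<le> C * dist x x')"

definition bilip_equiv :: "'a::metric_space set \<Rightarrow> 'b::metric_space set \<Rightarrow> bool" where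
  "bilip_equiv A B \<longleftrightarrow> (\<exists>C R. bilip_rel C R \<and> Domain R = A \<and> Range R = B)"

lemma bilip_rel_pos: "bilip_rel C R \<Longrightarrow> C > 0"
  by (simp add: bilip_rel_def)

lemma bilip_relD:
  assumes "bilip_rel C R" "(x, y) \<in> R" "(x', y') \<in> R"
  shows "dist x x' \<le> C * dist y y'" "dist y y' \<le> C * dist x x'"
  using assms unfolding bilip_rel_def by blast+

lemma bilip_rel_converse: "bilip_rel C R \<Longrightarrow> bilip_rel C (R\<inverse>)"
  unfolding bilip_rel_def by blast

lemma bilip_rel_subset: "bilip_rel C R \<Longrightarrow> R' \<subseteq> R \<Longrightarrow> bilip_rel C R'"
  unfolding bilip_rel_def by blast

lemma bilip_rel_mono:
  assumes R: "bilip_rel C R" and "C \<le> C'"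
  shows "bilip_rel C' R"
proof -
  have "C * dist a b \<le> C' * dist a b" for a b :: "'c::metric_space"
    using assms(2) by (intro mult_right_mono) auto
  moreover have "C * dist a b \<le> C' * dist a b" for a b :: "'d::metric_space"
    using assms(2) by (intro mult_right_mono) auto
  ultimately show ?thesis
    using assms unfolding bilip_rel_def by (meson order_trans order_less_le_trans)
qed

lemma bilip_rel_relcomp:
  assumes "bilip_rel C R" "bilip_rel C' R'"
  shows "bilip_rel (C * C') (R O R')"
proof -
  note C = bilip_rel_pos[OF assms(1)] bilip_rel_pos[OF assms(2)]
  have "dist x x' \<le> C * C' * dist z z' \<and> dist z z' \<le> C * C' * dist x x'"
    if *: "(x, y) \<in> R" "(y, z) \<in> R'" "(x', y') \<in> R" "(y', z') \<in> R'" for x y z x' y' z'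
  proof
    have "dist x x' \<le> C * dist y y'" by (rule bilip_relD[OF assms(1)]) fact+
    also have "\<dots> \<le> C * (C' * dist z z')"
      using C by (intro mult_left_mono bilip_relD[OF assms(2)] *) auto
    finally show "dist x x' \<le> C * C' * dist z z'" by simp
    have "dist z z' \<le> C' * dist y y'" by (rule bilip_relD[OF assms(2)]) fact+
    also have "\<dots> \<le> C' * (C * dist x x')"
      using C by (intro mult_left_mono bilip_relD[OF assms(1)] *) auto
    finally show "dist z z' \<le> C * C' * dist x x'" by (simp add: mult_ac)
  qed
  then show ?thesis using C unfolding bilip_rel_def by auto
qed

lemma bilip_equiv_sym: "bilip_equiv A B \<Longrightarrow> bilip_equiv B A"
  unfolding bilip_equiv_def by (metis bilip_rel_converse Domain_converse Range_converse)

lemma bilip_equiv_trans: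
  assumes "bilip_equiv A B" "bilip_equiv B C"
  shows "bilip_equiv A C"
proof -
  obtain c R c' R' where *: "bilip_rel c R" "Domain R = A" "Range R = B"
    "bilip_rel c' R'" "Domain R' = B" "Range R' = C"
    using assms unfolding bilip_equiv_def by blast
  have "Domain (R O R') = A" "Range (R O R') = C" using * by blast+
  then show ?thesis unfolding bilip_equiv_def using bilip_rel_relcomp * by blast
qed

text \<open>Between the two pieces all distances, on both sides, lie between \<open>d\<close> and
  \<open>M\<close>, so their quotients are at most \<open>M / d\<close>. The absolute value keeps
  the constant positive when a piece is empty and \<open>M\<close> is arbitrary.\<close>

lemma bilip_rel_Un:
  assumes R: "bilip_rel C R" "bilip_rel C R'" and d: "d > 0"
    and sep: "\<And>x y x' y'. (x, y) \<in> R \<Longrightarrow> (x', y') \<in> R' \<Longrightarrow>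
        d \<le> dist x x' \<and> d \<le> dist y y' \<and> dist x x' \<le> M \<and> dist y y' \<le> M"
  shows "bilip_rel (C + \<bar>M\<bar> / d) (R \<union> R')"
proof -
  note C = bilip_rel_pos[OF R(1)]
  let ?C = "C + \<bar>M\<bar> / d"
  have le: "a \<le> ?C * b" if "a \<le> C * b" "b \<ge> 0" for a b
  proof -
    have "\<bar>M\<bar> / d * b \<ge> 0" using d that(2) by simp
    then show ?thesis using that(1) by (simp add: distrib_right)
  qed
  have le': "a \<le> ?C * b" if "a \<le> M" "b \<ge> d" for a b
  proof -
    have "a \<le> \<bar>M\<bar> / d * d" using that(1) d by simp
    also have "\<dots> \<le> \<bar>M\<bar> / d * b" using that(2) d by (intro mult_left_mono) auto
    also have "\<dots> \<le> ?C * b" using C d that(2) by (intro mult_right_mono) auto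
    finally show ?thesis .
  qed
  have "dist x x' \<le> ?C * dist y y' \<and> dist y y' \<le> ?C * dist x x'"
    if "(x, y) \<in> R \<union> R'" "(x', y') \<in> R \<union> R'" for x y x' y'
    using that
  proof (elim UnE)
    assume "(x, y) \<in> R" "(x', y') \<in> R"
    then show ?thesis using bilip_relD[OF R(1)] le by (meson zero_le_dist)
  next
    assume "(x, y) \<in> R'" "(x', y') \<in> R'"
    then show ?thesis using bilip_relD[OF R(2)] le by (meson zero_le_dist)
  next
    assume "(x, y) \<in> R" "(x', y') \<in> R'"
    then show ?thesis using sep le' by blast
  next
    assume "(x, y) \<in> R'" "(x', y') \<in> R"
    then show ?thesis using sep le' by (metis dist_commute)
  qed
  then show ?thesis using C d unfolding bilip_rel_def by (auto simp: add_pos_nonneg)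
qed

lemma bilip_equiv_Un:
  assumes "bilip_equiv A B" "bilip_equiv A' B'" and d: "d > 0"
    and "\<And>x x'. x \<in> A \<Longrightarrow> x' \<in> A' \<Longrightarrow> d \<le> dist x x'" "\<And>y y'. y \<in> B \<Longrightarrow> y' \<in> B' \<Longrightarrow> d \<le> dist y y'"
    and "\<And>x x'. x \<in> A \<Longrightarrow> x' \<in> A' \<Longrightarrow> dist x x' \<le> M" "\<And>y y'. y \<in> B \<Longrightarrow> y' \<in> B' \<Longrightarrow> dist y y' \<le> M"
  shows "bilip_equiv (A \<union> A') (B \<union> B')"
proof -
  obtain C R C' R' where R: "bilip_rel C R" "Domain R = A" "Range R = B"
    "bilip_rel C' R'" "Domain R' = A'" "Range R' = B'"
    using assms(1,2) unfolding bilip_equiv_def by blast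
  have "bilip_rel (max C C' + \<bar>M\<bar> / d) (R \<union> R')"
    by (rule bilip_rel_Un) (use R assms bilip_rel_mono in \<open>fastforce+\<close>)
  then show ?thesis using R unfolding bilip_equiv_def by (metis Domain_Un_eq Range_Un_eq)
qed

lemma bilip_rel_graph:
  assumes "bilipschitz_map h A B"
  obtains C where "bilip_rel C {(x, h x) |x. x \<in> A}"
proof -
  obtain L where L: "L > 0" "\<forall>x\<in>A. \<forall>y\<in>A. dist x y / L \<le> dist (h x) (h y) \<and> dist (h x) (h y) \<le> L * dist x y"
    using assms unfolding bilipschitz_map_def by blast
  then have "bilip_rel L {(x, h x) |x. x \<in> A}"
    unfolding bilip_rel_def by (auto simp: field_simps)
  then show ?thesis using that by blast
qed

lemma bilip_equiv_imp_bilipschitz_map: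
  assumes "bilip_equiv A B"
  shows "\<exists>h. bilipschitz_map h A B \<and> h ` A = B"
proof -
  obtain C R where R: "bilip_rel C R" "Domain R = A" "Range R = B"
    using assms unfolding bilip_equiv_def by blast
  have "\<forall>x\<in>A. \<exists>y. (x, y) \<in> R" using R(2) by blast
  then obtain h where h: "\<And>x. x \<in> A \<Longrightarrow> (x, h x) \<in> R" by metis
  have "h ` A = B"
  proof
    show "h ` A \<subseteq> B" using h R(3) by blast
    show "B \<subseteq> h ` A"
    proof
      fix y assume "y \<in> B"
      then obtain x where x: "(x, y) \<in> R" using R(3) by blast
      then have "x \<in> A" using R(2) by blast
      then have "dist y (h x) \<le> C * dist x x" using bilip_relD[OF R(1) x h] by blast
      then show "y \<in> h ` A" using \<open>x \<in> A\<close> by simp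
    qed
  qed
  moreover have "bilipschitz_map h A B"
    unfolding bilipschitz_map_def
  proof (intro conjI exI[of _ C] ballI)
    show "C > 0" by (rule bilip_rel_pos) fact
    fix x y assume "x \<in> A" "y \<in> A"
    then show "dist x y / C \<le> dist (h x) (h y)" "dist (h x) (h y) \<le> C * dist x y"
      using bilip_relD[OF R(1) h h] \<open>C > 0\<close> by (auto simp: field_simps)
  qed (use \<open>h ` A = B\<close> in auto)
  ultimately show ?thesis by blast
qed

section \<open>Pointwise limits of bilipschitz relations\<close>

lemma dist_perturb:
  fixes a a' p p' :: "'a::metric_space"
  assumes "dist a p < \<epsilon>" "dist a' p' < \<epsilon>"
  shows "dist p p' \<le> dist a a' + 2 * \<epsilon>" "dist a a' \<le> dist p p' + 2 * \<epsilon>"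
proof -
  have "dist p p' \<le> dist a p + dist a a' + dist a' p'" by metric
  then show "dist p p' \<le> dist a a' + 2 * \<epsilon>" using assms by linarith
  have "dist a a' \<le> dist a p + dist p p' + dist a' p'" by metric
  then show "dist a a' \<le> dist p p' + 2 * \<epsilon>" using assms by linarith
qed

text \<open>By Tychonoff's theorem the functions have a cluster point in the product topology; the
  index set may be uncountable, so no convergent subsequence is sought. Closeness at two indices at
  once is what a bilipschitz estimate needs.\<close>

lemma compact_pointwise_cluster:
  fixes G :: "nat \<Rightarrow> 't \<Rightarrow> 'z::metric_space"
  assumes Z: "compact Z" and G: "\<And>q t. G q t \<in> Z"
  obtains H where "\<And>t. H t \<in> Z"
    "\<And>t u e n. e > 0 \<Longrightarrow> \<exists>q\<ge>n. dist (G q t) (H t) < e \<and> dist (G q u) (H u) < e"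
proof -
  have "compactin (product_topology (\<lambda>_. euclidean) UNIV) (PiE UNIV (\<lambda>_::'t. Z))"
    using Z by (simp add: compactin_PiE)
  then have "compact (PiE UNIV (\<lambda>_::'t. Z))"
    by (simp add: euclidean_product_topology)
  moreover have "filtermap G sequentially \<noteq> bot" by (simp add: filtermap_bot_iff)
  moreover have "\<forall>\<^sub>F x in filtermap G sequentially. x \<in> PiE UNIV (\<lambda>_. Z)"
    using G by (simp add: eventually_filtermap PiE_UNIV_domain)
  ultimately obtain H where H: "H \<in> PiE UNIV (\<lambda>_. Z)" "inf (nhds H) (filtermap G sequentially) \<noteq> bot"
    unfolding compact_filter by blast
  show ?thesis
  proof (rule that[of H])
    show "H t \<in> Z" for t using H(1) by (rule PiE_mem) simp
    fix t u :: 't and e :: real and n :: nat assume e: "e > 0"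
    let ?O = "{g. dist (g t) (H t) < e \<and> dist (g u) (H u) < e}"
    have "open {g :: 't \<Rightarrow> 'z. dist (g t) (H t) < e}" for t
      by (intro open_Collect_less continuous_intros continuous_on_product_coordinates)
    then have "open ?O" by (simp add: Collect_conj_eq open_Int)
    then have 1: "\<forall>\<^sub>F g in nhds H. g \<in> ?O" using e by (intro eventually_nhds_in_open) auto
    show "\<exists>q\<ge>n. dist (G q t) (H t) < e \<and> dist (G q u) (H u) < e"
    proof (rule ccontr)
      assume "\<not> ?thesis"
      then have "\<forall>\<^sub>F g in filtermap G sequentially. g \<notin> ?O"
        unfolding eventually_filtermap eventually_sequentially by blast
      with 1 have "\<forall>\<^sub>F g in inf (nhds H) (filtermap G sequentially). False"
        unfolding eventually_inf by blast
      then show False using H(2) by (simp add: trivial_limit_def)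
    qed
  qed
qed

text \<open>
  The limit is taken pointwise along a cluster point, simultaneously for approximants of the points
  of \<open>X\<close> and for preimages of the points of \<open>Y'\<close>; hence the sum type as index set.
\<close>

lemma bilip_rel_limit:
  fixes X :: "'a::metric_space set" and Y :: "'b::metric_space set"
  assumes X: "compact X" "X \<noteq> {}" and Y: "compact Y" and e: "e \<longlonglongrightarrow> (0::real)"
    and R: "\<And>q. R q \<subseteq> X \<times> Y" "\<And>q. bilip_rel C (R q)"
    and dense: "\<And>q x. x \<in> X \<Longrightarrow> \<exists>x'\<in>Domain (R q). dist x x' \<le> e q"
    and Y': "\<And>q. Y' \<subseteq> Range (R q)"
  obtains R' where "R' \<subseteq> X \<times> Y" "bilip_rel C R'" "Domain R' = X" "Y' \<subseteq> Range R'"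
proof -
  \<comment> \<open>The condition is void at indices that do not come from \<open>X\<close>, so that
    a single choice function covers the whole sum type.\<close>
  have "\<exists>p\<in>R q. \<forall>x\<in>X. t = Inl x \<longrightarrow> dist (fst p) x \<le> e q" for q and t :: "'a + 'b"
  proof (cases "\<exists>x\<in>X. t = Inl x")
    case True
    then obtain x where x: "x \<in> X" "t = Inl x" by blast
    then obtain x' y' where "(x', y') \<in> R q" "dist x x' \<le> e q" using dense by blast
    then show ?thesis using x by (auto simp: dist_commute intro!: bexI[of _ "(x', y')"])
  next
    case False
    obtain x where "x \<in> X" using X by blast
    then obtain p where "p \<in> R q" using dense[of x q] by auto
    then show ?thesis using False by blast
  qed
  moreover have "\<exists>p\<in>R q. snd p = y" if "y \<in> Y'" for q y
    using Y' that by force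
  ultimately have "\<exists>p\<in>R q. (\<forall>x\<in>X. t = Inl x \<longrightarrow> dist (fst p) x \<le> e q) \<and> (\<forall>y\<in>Y'. t = Inr y \<longrightarrow> snd p = y)"
    for q and t :: "'a + 'b"
    by (cases t) (metis Inl_Inr_False, metis Inl_Inr_False Inr_inject)
  then obtain G where G: "\<And>q t. G q t \<in> R q"
      "\<And>q x. x \<in> X \<Longrightarrow> dist (fst (G q (Inl x))) x \<le> e q"
      "\<And>q y. y \<in> Y' \<Longrightarrow> snd (G q (Inr y)) = y"
    by metis
  have "compact (X \<times> Y)" by (intro compact_Times X Y)
  moreover have "G q t \<in> X \<times> Y" for q t using G(1) R(1) by blast
  ultimately obtain H where H: "\<And>t. H t \<in> X \<times> Y"
    "\<And>t u e n. e > 0 \<Longrightarrow> \<exists>q\<ge>n. dist (G q t) (H t) < e \<and> dist (G q u) (H u) < e"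
    using compact_pointwise_cluster[of "X \<times> Y" G] by metis
  note C = bilip_rel_pos[OF R(2)]
  have close: "dist (fst a) (fst b) \<le> dist a b" "dist (snd a) (snd b) \<le> dist a b" for a b :: "'a \<times> 'b"
    by (rule dist_fst_le, rule dist_snd_le)
  have bilip: "dist (fst (H t)) (fst (H u)) \<le> C * dist (snd (H t)) (snd (H u)) \<and>
        dist (snd (H t)) (snd (H u)) \<le> C * dist (fst (H t)) (fst (H u))" for t u
  proof -
    \<comment> \<open>The factor \<open>2 + 2 * C\<close> collects the errors at both endpoints, in
      both spaces.\<close>
    have *: "dist (fst (H t)) (fst (H u)) \<le> C * dist (snd (H t)) (snd (H u)) + (2 + 2 * C) * \<epsilon> \<and>
        dist (snd (H t)) (snd (H u)) \<le> C * dist (fst (H t)) (fst (H u)) + (2 + 2 * C) * \<epsilon>"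
      if eps: "\<epsilon> > 0" for \<epsilon>
    proof -
      obtain q where q: "dist (G q t) (H t) < \<epsilon>" "dist (G q u) (H u) < \<epsilon>" using H(2)[OF eps] by blast
      define a b a' b' where "a = fst (G q t)" "b = snd (G q t)" "a' = fst (G q u)" "b' = snd (G q u)"
      have ab: "dist a a' \<le> C * dist b b'" "dist b b' \<le> C * dist a a'"
        using bilip_relD[OF R(2)[of q], of a b a' b'] G(1) by (auto simp: a_b_a'_b'_def)
      have near: "dist a (fst (H t)) < \<epsilon>" "dist a' (fst (H u)) < \<epsilon>"
          "dist b (snd (H t)) < \<epsilon>" "dist b' (snd (H u)) < \<epsilon>"
        using q close unfolding a_b_a'_b'_def by (meson order_le_less_trans)+
      have tri: "dist (fst (H t)) (fst (H u)) \<le> dist a a' + 2 * \<epsilon>" "dist a a' \<le> dist (fst (H t)) (fst (H u)) + 2 * \<epsilon>"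
        "dist (snd (H t)) (snd (H u)) \<le> dist b b' + 2 * \<epsilon>" "dist b b' \<le> dist (snd (H t)) (snd (H u)) + 2 * \<epsilon>"
        using dist_perturb near by blast+
      have "C * dist b b' \<le> C * (dist (snd (H t)) (snd (H u)) + 2 * \<epsilon>)"
        "C * dist a a' \<le> C * (dist (fst (H t)) (fst (H u)) + 2 * \<epsilon>)"
        using C tri by (auto intro!: mult_left_mono)
      then show ?thesis using tri ab by (simp add: algebra_simps)
    qed
    have lim: "a \<le> b" if "\<And>\<epsilon>. \<epsilon> > 0 \<Longrightarrow> a \<le> b + (2 + 2 * C) * \<epsilon>" for a b :: real
    proof (rule field_le_epsilon)
      fix \<epsilon> :: real assume "\<epsilon> > 0"
      then show "a \<le> b + \<epsilon>" using that[of "\<epsilon> / (2 + 2 * C)"] C by simp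
    qed
    show ?thesis using * lim by blast
  qed
  have H_Inl: "fst (H (Inl x)) = x" if "x \<in> X" for x
  proof -
    have "dist (fst (H (Inl x))) x \<le> 0 + \<epsilon>" if eps: "\<epsilon> > 0" for \<epsilon>
    proof -
      have "\<forall>\<^sub>F q in sequentially. e q < \<epsilon> / 2" using e eps by (intro order_tendstoD) auto
      then obtain n where n: "\<And>q. q \<ge> n \<Longrightarrow> e q < \<epsilon> / 2" unfolding eventually_sequentially by blast
      obtain q where q: "q \<ge> n" "dist (G q (Inl x)) (H (Inl x)) < \<epsilon> / 2" using H(2)[of "\<epsilon> / 2" n] eps by fastforce
      have "dist (fst (G q (Inl x))) (fst (H (Inl x))) < \<epsilon> / 2" using q(2) close(1) by (rule order_le_less_trans[rotated])
      moreover have "dist (fst (G q (Inl x))) x < \<epsilon> / 2" using G(2)[OF \<open>x \<in> X\<close>, of q] n[OF q(1)] by simp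
      ultimately show ?thesis by metric
    qed
    then have "dist (fst (H (Inl x))) x \<le> 0" by (rule field_le_epsilon)
    then show ?thesis by simp
  qed
  \<comment> \<open>Along the sequence the second coordinate at \<open>Inr y\<close> is exactly
    \<open>y\<close>, hence also at the cluster point; its partner in \<open>X\<close> may vary
    along the sequence.\<close>
  have H_Inr: "snd (H (Inr y)) = y" if "y \<in> Y'" for y
  proof -
    have "dist (snd (H (Inr y))) y \<le> 0 + \<epsilon>" if eps: "\<epsilon> > 0" for \<epsilon>
    proof -
      obtain q where q: "dist (G q (Inr y)) (H (Inr y)) < \<epsilon>" using H(2)[OF eps] by blast
      have "dist (snd (G q (Inr y))) (snd (H (Inr y))) < \<epsilon>" using q close(2) by (rule order_le_less_trans[rotated])
      then show ?thesis using G(3)[OF \<open>y \<in> Y'\<close>] by (simp add: dist_commute)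
    qed
    then have "dist (snd (H (Inr y))) y \<le> 0" by (rule field_le_epsilon)
    then show ?thesis by simp
  qed
  show ?thesis
  proof (rule that[of "range H"])
    show "range H \<subseteq> X \<times> Y" using H(1) by blast
    show "bilip_rel C (range H)"
      unfolding bilip_rel_def using C bilip by (metis (no_types, lifting) imageE fst_conv snd_conv)
    have "fst (H t) \<in> X" for t using H(1)[of t] by (simp add: mem_Times_iff)
    moreover have "x \<in> fst ` range H" if "x \<in> X" for x using H_Inl[OF that] by (metis rangeI imageI)
    ultimately show "Domain (range H) = X" unfolding Domain_fst by blast
    have "y \<in> snd ` range H" if "y \<in> Y'" for y using H_Inr[OF that] by (metis rangeI imageI)
    then show "Y' \<subseteq> Range (range H)" unfolding Range_snd by blast
  qed
qed

section \<open>Blow-ups and their limits\<close>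

context cantor_system
begin

lemma bilip_equiv_word_image:
  assumes "u \<in> lists {1..N}" "X \<subseteq> E"
  shows "bilip_equiv X (word_map f u ` X)"
proof -
  define C where "C = K * r u + K / r u"
  note r = r_pos[OF assms(1)]
  have "bilip_rel C {(x, word_map f u x) |x. x \<in> X}"
  proof -
    have "dist x y \<le> C * dist (word_map f u x) (word_map f u y) \<and>
          dist (word_map f u x) (word_map f u y) \<le> C * dist x y" if "x \<in> X" "y \<in> X" for x y
    proof
      have E: "x \<in> E" "y \<in> E" using that assms by auto
      have "dist x y \<le> K / r u * dist (word_map f u x) (word_map f u y)"
        using lower[OF assms(1) E] r by (simp add: field_simps)
      also have "\<dots> \<le> C * dist (word_map f u x) (word_map f u y)"
        unfolding C_def using r K_pos by (intro mult_right_mono) auto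
      finally show "dist x y \<le> C * dist (word_map f u x) (word_map f u y)" .
      have "dist (word_map f u x) (word_map f u y) \<le> K * r u * dist x y"
        by (rule upper[OF assms(1) E])
      also have "\<dots> \<le> C * dist x y"
        unfolding C_def using r K_pos by (intro mult_right_mono) auto
      finally show "dist (word_map f u x) (word_map f u y) \<le> C * dist x y" .
    qed
    moreover have "C > 0" using r K_pos by (simp add: C_def add_pos_pos)
    ultimately show ?thesis unfolding bilip_rel_def by blast
  qed
  moreover have "Domain {(x, word_map f u x) |x. x \<in> X} = X"
    "Range {(x, word_map f u x) |x. x \<in> X} = word_map f u ` X" by blast+
  ultimately show ?thesis unfolding bilip_equiv_def by blast
qed

section \<open>Gaps around cylinders\<close>

lemma diameter_pos: "diameter E > 0"
proof -
  obtain \<delta> where \<delta>: "\<delta> > 0"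
    "\<And>v w x y. v \<in> words 1 \<Longrightarrow> w \<in> words 1 \<Longrightarrow> v \<noteq> w \<Longrightarrow> x \<in> cyl v \<Longrightarrow> y \<in> cyl w \<Longrightarrow> \<delta> \<le> dist x y"
    using separated_words[of 1] by metis
  have w: "[1] \<in> words 1" "[2] \<in> words 1" using N_ge_2 by (auto simp: words_def)
  obtain x y where xy: "x \<in> cyl [1]" "y \<in> cyl [2]" using cyl_ne by blast
  then have "\<delta> \<le> dist x y" using \<delta>(2)[OF w] by simp
  moreover have "x \<in> E" "y \<in> E" using xy w wordsD(1) cyl_subset_E by blast+
  ultimately show ?thesis using \<delta>(1) dist_le_diameter[of x y] by linarith
qed

text \<open>Both ratios are read off from one pair of distinct points: the inner word does not
  increase its distance, and the outer word scales by \<open>r u\<close> up to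
  \<open>K\<close>.\<close>

lemma r_append_le:
  assumes "u \<in> lists {1..N}" "w \<in> lists {1..N}"
  shows "r (u @ w) \<le> K * K * r u"
proof -
  obtain x y where xy: "x \<in> E" "y \<in> E" "x \<noteq> y"
  proof (rule ccontr)
    assume "\<not> thesis"
    then have "\<forall>x\<in>E. \<forall>y\<in>E. x = y" using that by blast
    then have "diameter E \<le> 0" by (intro diameter_leI) auto
    then show False using diameter_pos by simp
  qed
  have uw: "u @ w \<in> lists {1..N}" using assms by simp
  have "r (u @ w) * dist x y \<le> K * dist (word_map f (u @ w) x) (word_map f (u @ w) y)"
    by (rule lower[OF uw]) fact+
  also have "\<dots> \<le> K * (K * r u * dist (word_map f w x) (word_map f w y))"
    unfolding word_map_append using K_pos assms xy by (intro mult_left_mono upper word_map_in_E) auto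
  also have "\<dots> \<le> K * (K * r u * dist x y)"
  proof (intro mult_left_mono)
    have "dist (word_map f w x) (word_map f w y) \<le> L ^ length w * dist x y"
      using assms xy by (intro word_map_contraction)
    also have "\<dots> \<le> 1 * dist x y" using L_pos L_less by (intro mult_right_mono power_le_one) auto
    finally show "dist (word_map f w x) (word_map f w y) \<le> dist x y" by simp
  qed (use K_pos r_pos[OF assms(1)] in auto)
  finally have "r (u @ w) * dist x y \<le> K * K * r u * dist x y" by (simp add: mult_ac)
  then show ?thesis using xy by simp
qed

text \<open>Let \<open>p\<close> be the longest prefix of \<open>u\<close> whose cylinder contains
  \<open>z\<close>. Then \<open>x\<close> and \<open>z\<close> lie in different children of
  \<open>p\<close>, so before \<open>p\<close> is applied they are at distance at least
  \<open>\<delta>\<close>, and \<open>r p\<close> is at least \<open>r u / (K * K)\<close>.\<close>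

lemma separated_cyl:
  obtains \<eta> where "\<eta> > 0"
    "\<And>u x z. u \<in> lists {1..N} \<Longrightarrow> x \<in> cyl u \<Longrightarrow> z \<in> E \<Longrightarrow> z \<notin> cyl u \<Longrightarrow> \<eta> * r u \<le> dist x z"
proof -
  obtain \<delta> where \<delta>: "\<delta> > 0"
    "\<And>v w x y. v \<in> words 1 \<Longrightarrow> w \<in> words 1 \<Longrightarrow> v \<noteq> w \<Longrightarrow> x \<in> cyl v \<Longrightarrow> y \<in> cyl w \<Longrightarrow> \<delta> \<le> dist x y"
    using separated_words[of 1] by metis
  have branch: "\<exists>p i w. u = p @ i # w \<and> z \<in> cyl p \<and> z \<notin> cyl (p @ [i])" if "z \<in> E" "z \<notin> cyl u" for u z
    using that
  proof (induction u rule: rev_induct)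
    case (snoc i u)
    then show ?case by (cases "z \<in> cyl u") fastforce+
  qed simp
  show ?thesis
  \<comment> \<open>Two factors \<open>K\<close> come from comparing \<open>r u\<close> with
    \<open>r p\<close>, the third from the lower bound for the map of \<open>p\<close>.\<close>
  proof (rule that[of "\<delta> / (K * K * K)"])
    show "\<delta> / (K * K * K) > 0" using \<delta>(1) K_pos by simp
    fix u x z assume *: "u \<in> lists {1..N}" "x \<in> cyl u" "z \<in> E" "z \<notin> cyl u"
    obtain p i w where u: "u = p @ i # w" "z \<in> cyl p" "z \<notin> cyl (p @ [i])" using branch * by blast
    have p: "p \<in> lists {1..N}" and i: "i \<in> {1..N}" and w: "w \<in> lists {1..N}" using * u by auto
    obtain z' where z': "z' \<in> E" "z = word_map f p z'" using u(2) by (auto simp: cyl_def)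
    obtain x' where x': "x' \<in> cyl (i # w)" "x = word_map f p x'" using *(2) unfolding u cyl_append by blast
    have x'_i: "x' \<in> cyl [i]" using x'(1) cyl_subset_E[OF w] by (auto simp: cyl_Cons)
    have i1: "[i] \<in> words 1" using i by (auto simp: words_def)
    obtain v where v: "v \<in> words 1" "z' \<in> cyl v" using E_in_words z' by blast
    have "v \<noteq> [i]" using u(3) v(2) z'(2) unfolding cyl_append by blast
    then have "\<delta> \<le> dist x' z'" using \<delta>(2)[OF i1 v(1) _ x'_i v(2)] by blast
    have x'E: "x' \<in> E" using x'_i cyl_subset_E wordsD(1)[OF i1] by blast
    have "\<delta> / (K * K * K) * r u \<le> \<delta> / (K * K * K) * (K * K * r p)"
      using r_append_le[OF p, of "i # w"] i w \<delta>(1) K_pos unfolding u by (intro mult_left_mono) auto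
    also have "\<dots> = r p * \<delta> / K" using K_pos by simp
    also have "\<dots> \<le> r p * dist x' z' / K"
      using K_pos r_pos[OF p] \<open>\<delta> \<le> _\<close> by (intro divide_right_mono mult_left_mono) auto
    also have "\<dots> \<le> dist x z"
      using lower[OF p x'E z'(1)] K_pos unfolding x' z' by (simp add: field_simps)
    finally show "\<delta> / (K * K * K) * r u \<le> dist x z" .
  qed
qed

text \<open>Pulled back along either map, \<open>D\<close> is empty or, by induction, equivalent to
  \<open>E\<close>. If one part is empty, \<open>D\<close> is a copy of the other; if neither is,
  the two equivalences are glued, and the two full first-level cylinders make up \<open>E\<close>
  because there are only two maps.\<close>

lemma bilip_equiv_cyl_union:
  assumes "N = 2" "D \<subseteq> E" "D \<noteq> {}" "\<And>w. w \<in> words p \<Longrightarrow> cyl w \<inter> D \<noteq> {} \<Longrightarrow> cyl w \<subseteq> D"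
  shows "bilip_equiv D E"
  using assms(2-)
proof (induction p arbitrary: D)
  case 0
  then have "D = E" by auto
  moreover have "bilip_equiv E E" using bilip_equiv_word_image[of "[]" E] by simp
  ultimately show ?case by simp
next
  case (Suc p)
  obtain \<delta> where \<delta>: "\<delta> > 0"
    "\<And>v w x y. v \<in> words 1 \<Longrightarrow> w \<in> words 1 \<Longrightarrow> v \<noteq> w \<Longrightarrow> x \<in> cyl v \<Longrightarrow> y \<in> cyl w \<Longrightarrow> \<delta> \<le> dist x y"
    using separated_words[of 1] by metis
  have w12: "[1] \<in> words 1" "[2] \<in> words 1" using N_ge_2 by (auto simp: words_def)
  define P where "P i = {x \<in> E. f i x \<in> D}" for i
  have P_E: "P i \<subseteq> E" for i by (auto simp: P_def)
  have img: "f i ` X = word_map f [i] ` X" for i X by simp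
  have E12: "E = f 1 ` E \<union> f 2 ` E"
  proof -
    have "{1..N} = {1, 2}" using assms(1) by auto
    then show ?thesis using E_eq by auto
  qed
  have D12: "D = f 1 ` P 1 \<union> f 2 ` P 2"
  proof -
    have "D \<subseteq> f 1 ` E \<union> f 2 ` E" using Suc.prems(1) E12 by simp
    then show ?thesis unfolding P_def by blast
  qed
  have f_equiv: "bilip_equiv X (f i ` X)" if "i \<in> {1, 2}" "X \<subseteq> E" for i X
    unfolding img using that assms(1) by (intro bilip_equiv_word_image) auto
  have P_equiv: "bilip_equiv (P i) E" if i: "i \<in> {1, 2}" "P i \<noteq> {}" for i
  proof (rule Suc.IH)
    fix w assume w: "w \<in> words p" "cyl w \<inter> P i \<noteq> {}"
    have iw: "i # w \<in> words (Suc p)" using w i N_ge_2 by (auto simp: words_def)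
    have "cyl (i # w) \<inter> D \<noteq> {}" using w(2) by (auto simp: cyl_Cons P_def)
    then have "cyl (i # w) \<subseteq> D" using Suc.prems(3) iw by blast
    then show "cyl w \<subseteq> P i" using cyl_subset_E[OF wordsD(1)[OF w(1)]] by (auto simp: cyl_Cons P_def)
  qed (use P_E i in auto)
  consider "P 1 = {}" "P 2 \<noteq> {}" | "P 1 \<noteq> {}" "P 2 = {}" | "P 1 \<noteq> {}" "P 2 \<noteq> {}"
    using Suc.prems(2) D12 by blast
  then show ?case
  proof cases
    case 1
    then have "D = f 2 ` P 2" using D12 by simp
    then show ?thesis
      using P_equiv[of 2] f_equiv[of 2 "P 2"] P_E 1 by (auto intro: bilip_equiv_trans bilip_equiv_sym)
  next
    case 2
    then have "D = f 1 ` P 1" using D12 by simp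
    then show ?thesis
      using P_equiv[of 1] f_equiv[of 1 "P 1"] P_E 2 by (auto intro: bilip_equiv_trans bilip_equiv_sym)
  next
    case 3
    have eq: "bilip_equiv (f i ` P i) (f i ` E)" if "i \<in> {1, 2}" for i
    proof -
      have ne: "P i \<noteq> {}" using that 3 by auto
      show ?thesis
        by (rule bilip_equiv_trans[OF bilip_equiv_sym[OF f_equiv[OF that P_E]]
              bilip_equiv_trans[OF P_equiv[OF that ne] f_equiv[OF that subset_refl]]])
    qed
    have sep: "\<delta> \<le> dist x y" if "x \<in> f 1 ` E" "y \<in> f 2 ` E" for x y
      using \<delta>(2)[OF w12, of x y] that by (auto simp: cyl_Cons)
    have bd: "dist x y \<le> diameter E" if "x \<in> f 1 ` E" "y \<in> f 2 ` E" for x y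
      using that E12 by (intro dist_le_diameter) auto
    have e1: "bilip_equiv (f 1 ` P 1) (f 1 ` E)" and e2: "bilip_equiv (f 2 ` P 2) (f 2 ` E)"
      by (rule eq, simp)+
    have sub: "x \<in> f i ` E" if "x \<in> f i ` P i" for x i using that P_E by blast
    have "bilip_equiv (f 1 ` P 1 \<union> f 2 ` P 2) (f 1 ` E \<union> f 2 ` E)"
      by (rule bilip_equiv_Un[OF e1 e2 \<delta>(1), where M = "diameter E"])
        (rule sep bd; (assumption | (rule sub, assumption)))+
    then show ?thesis by (simp only: D12[symmetric] E12[symmetric])
  qed
qed

end

section \<open>Blow-ups of a relation between two Cantor sets\<close>

definition rescale_rel :: "'a set \<Rightarrow> 'b set \<Rightarrow> ('a \<Rightarrow> 'a) \<Rightarrow> ('b \<Rightarrow> 'b) \<Rightarrow> ('a \<times> 'b) set \<Rightarrow> ('a \<times> 'b) set" where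
  "rescale_rel X Y \<phi> \<psi> S = {(x, y). x \<in> X \<and> y \<in> Y \<and> (\<phi> x, \<psi> y) \<in> S}"

locale cantor_pair =
  X: cantor_system E N f r K L + Y: cantor_system F M g \<rho> K' L'
  for E :: "'a::heine_borel set" and N f r K L
    and F :: "'b::heine_borel set" and M g \<rho> K' L'
begin

abbreviation rescale :: "nat list \<Rightarrow> nat list \<Rightarrow> ('a \<times> 'b) set \<Rightarrow> ('a \<times> 'b) set" where
  "rescale u v S \<equiv> rescale_rel E F (word_map f u) (word_map g v) S"

text \<open>
  Blow-up: near a cylinder of \<open>E\<close> in which \<open>Domain S\<close> is dense at scale \<open>q\<close>, magnify \<open>E\<close> by that
  cylinder and \<open>F\<close> by the smallest cylinder containing the image. The ratio of the two magnifications
  is bounded because both the magnified domain and its image have diameter bounded below.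
\<close>

lemma zoom:
  assumes S: "S \<subseteq> E \<times> F" "bilip_rel C0 S"
    and s: "s > 0" "hausdorff_measure s E < \<infinity>" "hausdorff_measure s (Domain S) > 0"
  obtains C where "C > 0"
    "\<And>q. \<exists>u\<in>lists {1..N}. \<exists>v\<in>lists {1..M}. bilip_rel C (rescale u v S) \<and>
       (\<forall>w\<in>X.words (Suc q). Domain (rescale u v S) \<inter> X.cyl w \<noteq> {}) \<and>
       (\<forall>x y. (x, y) \<in> S \<longrightarrow> x \<in> X.cyl u \<longrightarrow> y \<in> Y.cyl v) \<and> \<rho> v \<le> C * r u"
proof -
  obtain \<delta> where \<delta>: "\<delta> > 0"
    "\<And>v w x y. v \<in> X.words 1 \<Longrightarrow> w \<in> X.words 1 \<Longrightarrow> v \<noteq> w \<Longrightarrow> x \<in> X.cyl v \<Longrightarrow> y \<in> X.cyl w \<Longrightarrow> \<delta> \<le> dist x y"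
    using X.separated_words[of 1] by metis
  obtain \<delta>' where \<delta>': "\<delta>' > 0"
    "\<And>v w x y. v \<in> Y.words 1 \<Longrightarrow> w \<in> Y.words 1 \<Longrightarrow> v \<noteq> w \<Longrightarrow> x \<in> Y.cyl v \<Longrightarrow> y \<in> Y.cyl w \<Longrightarrow> \<delta>' \<le> dist x y"
    using Y.separated_words[of 1] by metis
  note C0 = bilip_rel_pos[OF S(2)]
  \<comment> \<open>\<open>B\<close> is the loss of one comparison through \<open>S\<close> and two
    word maps. The summands of the next constant \<open>Q\<close> serve to bound
    \<open>r u / \<rho> v\<close> and its inverse.\<close>
  define B where "B = K * K' * C0"
  define Q where "Q = B * (diameter F / \<delta> + diameter E / \<delta>')"
  have B: "B > 0" using X.K_pos Y.K_pos C0 by (simp add: B_def)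
  have Q: "Q > 0" using B \<delta>(1) \<delta>'(1) X.diameter_pos Y.diameter_pos by (simp add: Q_def add_pos_pos)
  have "\<exists>u\<in>lists {1..N}. \<exists>v\<in>lists {1..M}. bilip_rel (B * Q + Q) (rescale u v S) \<and>
       (\<forall>w\<in>X.words (Suc q). Domain (rescale u v S) \<inter> X.cyl w \<noteq> {}) \<and>
       (\<forall>x y. (x, y) \<in> S \<longrightarrow> x \<in> X.cyl u \<longrightarrow> y \<in> Y.cyl v) \<and> \<rho> v \<le> (B * Q + Q) * r u" for q
  proof -
    have "Domain S \<subseteq> E" using S(1) by blast
    then obtain u where u: "u \<in> lists {1..N}"
      and dense: "\<And>w. w \<in> X.words (Suc q) \<Longrightarrow> Domain S \<inter> X.cyl (u @ w) \<noteq> {}"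
      using X.dense_in_some_cyl[OF s(1,2) _ s(3), of "Suc q"] by metis
    have ru: "r u > 0" using X.r_pos u .
    \<comment> \<open>Padding to length \<open>Suc q\<close> brings the words under the density
      condition, while their different first letters keep \<open>x1\<close> and \<open>x2\<close> at
      distance at least \<open>\<delta>\<close>.\<close>
    have w12: "1 # replicate q 1 \<in> X.words (Suc q)" "2 # replicate q 1 \<in> X.words (Suc q)"
      "[1] \<in> X.words 1" "[2] \<in> X.words 1"
      using X.N_ge_2 by (auto simp: X.words_def)
    have lift: "\<exists>x' y. x' \<in> X.cyl w \<and> (word_map f u x', y) \<in> S" if "w \<in> X.words (Suc q)" for w
      using dense[OF that] unfolding X.cyl_append by blast
    obtain x1 y1 where xy1: "x1 \<in> X.cyl (1 # replicate q 1)" "(word_map f u x1, y1) \<in> S"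
      using lift w12 by blast
    obtain x2 y2 where xy2: "x2 \<in> X.cyl (2 # replicate q 1)" "(word_map f u x2, y2) \<in> S"
      using lift w12 by blast
    have rep: "replicate q 1 \<in> lists {1..N}" using X.N_ge_2 by auto
    have x1: "x1 \<in> X.cyl [1]" "x1 \<in> E"
      using xy1(1) X.cyl_Cons_subset[OF rep] X.cyl_subset_E[OF X.wordsD(1)[OF w12(1)]] by blast+
    have x2: "x2 \<in> X.cyl [2]" "x2 \<in> E"
      using xy2(1) X.cyl_Cons_subset[OF rep] X.cyl_subset_E[OF X.wordsD(1)[OF w12(2)]] by blast+
    have d12: "\<delta> \<le> dist x1 x2" using \<delta>(2)[OF w12(3,4) _ x1(1) x2(1)] by simp
    define T where "T = {y. \<exists>x\<in>X.cyl u. (x, y) \<in> S}"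
    have T_F: "T \<subseteq> F" using S(1) by (auto simp: T_def)
    have in_cyl_u: "word_map f u x \<in> X.cyl u" if "x \<in> E" for x using that by (auto simp: X.cyl_def)
    have yT: "y1 \<in> T" "y2 \<in> T" using xy1 xy2 in_cyl_u x1 x2 by (auto simp: T_def)
    have "y1 \<noteq> y2"
    proof
      assume "y1 = y2"
      then have "word_map f u x1 = word_map f u x2" using bilip_relD(1)[OF S(2) xy1(2) xy2(2)] by simp
      then have "x1 = x2" using X.inj_word_map[OF u] x1 x2 by (simp add: inj_on_def)
      then show False using d12 \<delta>(1) by simp
    qed
    \<comment> \<open>The cylinder of \<open>v\<close> is taken at the deepest level at which one
      cylinder contains \<open>T\<close>. That level exists because the distinct points
      \<open>y1\<close> and \<open>y2\<close> do not fit into arbitrarily small cylinders.\<close>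
    define P where "P n \<longleftrightarrow> (\<exists>v\<in>Y.words n. T \<subseteq> Y.cyl v)" for n
    have P0: "P 0" using T_F by (simp add: P_def)
    obtain n0 where n0: "L' ^ Suc n0 * diameter F < dist y1 y2"
      using Y.power_L_small[of "dist y1 y2"] \<open>y1 \<noteq> y2\<close> by auto
    have bound: "n \<le> n0" if "P n" for n
    proof (rule ccontr)
      assume "\<not> n \<le> n0"
      obtain v where v: "v \<in> Y.words n" "T \<subseteq> Y.cyl v" using \<open>P n\<close> by (auto simp: P_def)
      have "dist y1 y2 \<le> L' ^ length v * diameter F"
        using yT v Y.wordsD by (intro Y.dist_cyl_le) auto
      also have "\<dots> \<le> L' ^ Suc n0 * diameter F"
        using \<open>\<not> n \<le> n0\<close> Y.wordsD[OF v(1)] Y.L_pos Y.L_less Y.diameter_nonneg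
        by (intro mult_right_mono power_decreasing) auto
      finally show False using n0 by simp
    qed
    define n where "n = Greatest P"
    have "P n" unfolding n_def by (rule GreatestI_nat[of P, OF P0 bound])
    have "\<not> P (Suc n)" using Greatest_le_nat[of P "Suc n", OF _ bound] unfolding n_def by auto
    obtain v where v: "v \<in> Y.words n" "T \<subseteq> Y.cyl v" using \<open>P n\<close> by (auto simp: P_def)
    have v': "v \<in> lists {1..M}" using Y.wordsD v by blast
    have rv: "\<rho> v > 0" using Y.r_pos v' .
    define R where "R = rescale u v S"
    have R_E: "x \<in> E" "y \<in> F" "(word_map f u x, word_map g v y) \<in> S" if "(x, y) \<in> R" for x y
      using that by (auto simp: R_def rescale_rel_def)
    have R_I: "\<exists>y'. (x, y') \<in> R \<and> y = word_map g v y'" if "(word_map f u x, y) \<in> S" "x \<in> E" for x y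
    proof -
      have "y \<in> T" using that in_cyl_u by (auto simp: T_def)
      then have "y \<in> Y.cyl v" using v by blast
      then obtain y' where "y = word_map g v y'" "y' \<in> F" by (auto simp: Y.cyl_def)
      then show ?thesis using that by (auto simp: R_def rescale_rel_def)
    qed
    have scaled: "r u * dist x x' \<le> B * \<rho> v * dist y y'" "\<rho> v * dist y y' \<le> B * r u * dist x x'"
      if "(x, y) \<in> R" "(x', y') \<in> R" for x y x' y'
    proof -
      note * = R_E[OF that(1)] R_E[OF that(2)]
      have "r u * dist x x' \<le> K * dist (word_map f u x) (word_map f u x')" by (rule X.lower[OF u *(1,4)])
      also have "\<dots> \<le> K * (C0 * dist (word_map g v y) (word_map g v y'))"
        using X.K_pos by (intro mult_left_mono bilip_relD(1)[OF S(2) *(3,6)]) auto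
      also have "\<dots> \<le> K * (C0 * (K' * \<rho> v * dist y y'))"
        using X.K_pos C0 by (intro mult_left_mono Y.upper[OF v' *(2,5)]) auto
      finally show "r u * dist x x' \<le> B * \<rho> v * dist y y'" by (simp add: B_def mult_ac)
      have "\<rho> v * dist y y' \<le> K' * dist (word_map g v y) (word_map g v y')" by (rule Y.lower[OF v' *(2,5)])
      also have "\<dots> \<le> K' * (C0 * dist (word_map f u x) (word_map f u x'))"
        using Y.K_pos by (intro mult_left_mono bilip_relD(2)[OF S(2) *(3,6)]) auto
      also have "\<dots> \<le> K' * (C0 * (K * r u * dist x x'))"
        using Y.K_pos C0 by (intro mult_left_mono X.upper[OF u *(1,4)]) auto
      finally show "\<rho> v * dist y y' \<le> B * r u * dist x x'" by (simp add: B_def mult_ac)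
    qed
    obtain z1 where z1: "(x1, z1) \<in> R" "y1 = word_map g v z1" using R_I xy1 x1 by blast
    obtain z2 where z2: "(x2, z2) \<in> R" "y2 = word_map g v z2" using R_I xy2 x2 by blast
    \<comment> \<open>Two points of the magnified domain at distance \<open>\<delta>\<close> keep
      the cylinder of \<open>v\<close> from being too small compared with that of
      \<open>u\<close>.\<close>
    have "r u * \<delta> \<le> r u * dist x1 x2" using d12 ru by simp
    also have "\<dots> \<le> B * \<rho> v * dist z1 z2" by (rule scaled(1)[OF z1(1) z2(1)])
    also have "\<dots> \<le> B * \<rho> v * diameter F"
      using B rv Y.dist_le_diameter R_E z1 z2 by (intro mult_left_mono) auto
    finally have "r u \<le> B * (diameter F / \<delta>) * \<rho> v" using \<delta>(1) by (simp add: field_simps)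
    also have "\<dots> \<le> Q * \<rho> v"
      unfolding Q_def using B rv \<delta>'(1) X.diameter_nonneg by (intro mult_right_mono mult_left_mono) auto
    finally have ratio1: "r u \<le> Q * \<rho> v" .
    \<comment> \<open>By maximality of the level, the child of \<open>v\<close> containing
      \<open>y1\<close> misses a point of \<open>T\<close>. This gives a second pair, now separated
      in the magnified copy of \<open>F\<close>, and with it the opposite ratio bound.\<close>
    obtain j where j: "j \<in> Y.words 1" "z1 \<in> Y.cyl j" using Y.E_in_words R_E z1 by metis
    have "v @ j \<in> Y.words (Suc n)" using v(1) j(1) by (auto simp: Y.words_def)
    then have "\<not> T \<subseteq> Y.cyl (v @ j)" using \<open>\<not> P (Suc n)\<close> by (auto simp: P_def)
    then obtain y3 where "y3 \<in> T" and y3: "y3 \<notin> Y.cyl (v @ j)" by blast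
    then obtain x3 where x3: "x3 \<in> E" "(word_map f u x3, y3) \<in> S" by (auto simp: T_def X.cyl_def)
    then obtain z3 where z3: "(x3, z3) \<in> R" "y3 = word_map g v z3" using R_I by blast
    obtain j' where j': "j' \<in> Y.words 1" "z3 \<in> Y.cyl j'" using Y.E_in_words R_E z3 by metis
    have "j \<noteq> j'" using y3 z3 j' unfolding Y.cyl_append by blast
    then have d13: "\<delta>' \<le> dist z1 z3" using \<delta>'(2) j j' by blast
    have "\<rho> v * \<delta>' \<le> \<rho> v * dist z1 z3" using d13 rv by simp
    also have "\<dots> \<le> B * r u * dist x1 x3" by (rule scaled(2)[OF z1(1) z3(1)])
    also have "\<dots> \<le> B * r u * diameter E"
      using B ru X.dist_le_diameter x1 x3 by (intro mult_left_mono) auto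
    finally have "\<rho> v \<le> B * (diameter E / \<delta>') * r u" using \<delta>'(1) by (simp add: field_simps)
    also have "\<dots> \<le> Q * r u"
      unfolding Q_def using B ru \<delta>(1) Y.diameter_nonneg by (intro mult_right_mono mult_left_mono) auto
    finally have ratio2: "\<rho> v \<le> Q * r u" .
    have "bilip_rel (B * Q) R"
    proof -
      have "dist x x' \<le> B * Q * dist y y' \<and> dist y y' \<le> B * Q * dist x x'"
        if "(x, y) \<in> R" "(x', y') \<in> R" for x y x' y'
      proof
        have "r u * dist x x' \<le> B * \<rho> v * dist y y'" by (rule scaled(1)[OF that])
        also have "\<dots> \<le> B * (Q * r u) * dist y y'" using B ratio2 by (intro mult_right_mono mult_left_mono) auto
        finally have "r u * dist x x' \<le> r u * (B * Q * dist y y')" by (simp add: mult_ac)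
        then show "dist x x' \<le> B * Q * dist y y'" using ru by simp
        have "\<rho> v * dist y y' \<le> B * r u * dist x x'" by (rule scaled(2)[OF that])
        also have "\<dots> \<le> B * (Q * \<rho> v) * dist x x'" using B ratio1 by (intro mult_right_mono mult_left_mono) auto
        finally have "\<rho> v * dist y y' \<le> \<rho> v * (B * Q * dist x x')" by (simp add: mult_ac)
        then show "dist y y' \<le> B * Q * dist x x'" using rv by simp
      qed
      then show ?thesis unfolding bilip_rel_def using B Q by auto
    qed
    then have "bilip_rel (B * Q + Q) R" using Q by (elim bilip_rel_mono) simp
    moreover have "Domain R \<inter> X.cyl w \<noteq> {}" if w: "w \<in> X.words (Suc q)" for w
    proof -
      obtain x y where xy: "x \<in> X.cyl w" "(word_map f u x, y) \<in> S" using lift[OF w] by blast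
      then show ?thesis using R_I[OF xy(2)] X.cyl_subset_E[OF X.wordsD(1)[OF w]] by blast
    qed
    moreover have "y \<in> Y.cyl v" if "(x, y) \<in> S" "x \<in> X.cyl u" for x y
      using that v(2) by (auto simp: T_def)
    moreover have "\<rho> v \<le> (B * Q + Q) * r u"
    proof -
      have "0 \<le> B * Q * r u" using B Q ru by simp
      then show ?thesis using ratio2 by (simp add: distrib_right)
    qed
    ultimately show ?thesis using u v' unfolding R_def by blast
  qed
  moreover have "B * Q + Q > 0" using B Q by (simp add: add_pos_pos)
  ultimately show ?thesis using that by blast
qed

text \<open>The domain of the blow-up at stage \<open>q\<close> is dense up to
  \<open>L ^ Suc q * diameter E\<close>. As this tends to 0 while \<open>C\<close> stays fixed, the
  limit is defined on all of \<open>E\<close>.\<close>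

lemma embedding:
  assumes S: "S \<subseteq> E \<times> F" "bilip_rel C0 S"
    and s: "s > 0" "hausdorff_measure s E < \<infinity>" "hausdorff_measure s (Domain S) > 0"
  obtains C R where "R \<subseteq> E \<times> F" "bilip_rel C R" "Domain R = E"
proof -
  obtain C where C: "C > 0"
    "\<And>q. \<exists>u\<in>lists {1..N}. \<exists>v\<in>lists {1..M}. bilip_rel C (rescale u v S) \<and>
       (\<forall>w\<in>X.words (Suc q). Domain (rescale u v S) \<inter> X.cyl w \<noteq> {}) \<and>
       (\<forall>x y. (x, y) \<in> S \<longrightarrow> x \<in> X.cyl u \<longrightarrow> y \<in> Y.cyl v) \<and> \<rho> v \<le> C * r u"
    using zoom[OF S s] by metis
  have "\<exists>R. R \<subseteq> E \<times> F \<and> bilip_rel C R \<and> (\<forall>w\<in>X.words (Suc q). Domain R \<inter> X.cyl w \<noteq> {})" for q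
  proof -
    have "rescale u v S \<subseteq> E \<times> F" for u v by (auto simp: rescale_rel_def)
    then show ?thesis using C(2)[of q] by blast
  qed
  then obtain R where R: "\<And>q. R q \<subseteq> E \<times> F" "\<And>q. bilip_rel C (R q)"
     "\<And>q w. w \<in> X.words (Suc q) \<Longrightarrow> Domain (R q) \<inter> X.cyl w \<noteq> {}"
    by metis
  have dense: "\<exists>x'\<in>Domain (R q). dist x x' \<le> L ^ Suc q * diameter E" if "x \<in> E" for q x
    using X.dense_if_meets_cyls R(3) that by blast
  show ?thesis
    by (rule bilip_rel_limit[OF X.compact_E X.E_ne Y.compact_E X.power_L_tendsto R(1,2) dense empty_subsetI])
      (assumption, rule that)
qed

text \<open>
  If \<open>S\<close> covers \<open>F\<close>, the ranges of the blow-ups are unions of cylinders of a fixed level, so one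
  cylinder lies in infinitely many of them.
\<close>

lemma embedding_onto_cyl:
  assumes S: "S \<subseteq> E \<times> F" "bilip_rel C0 S" "Range S = F"
    and s: "s > 0" "hausdorff_measure s E < \<infinity>" "hausdorff_measure s (Domain S) > 0"
  obtains C R w where "R \<subseteq> E \<times> F" "bilip_rel C R" "Domain R = E" "w \<in> lists {1..M}" "Y.cyl w \<subseteq> Range R"
proof -
  obtain C where C: "C > 0"
    "\<And>q. \<exists>u\<in>lists {1..N}. \<exists>v\<in>lists {1..M}. bilip_rel C (rescale u v S) \<and>
       (\<forall>w\<in>X.words (Suc q). Domain (rescale u v S) \<inter> X.cyl w \<noteq> {}) \<and>
       (\<forall>x y. (x, y) \<in> S \<longrightarrow> x \<in> X.cyl u \<longrightarrow> y \<in> Y.cyl v) \<and> \<rho> v \<le> C * r u"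
    using zoom[OF S(1,2) s] by metis
  note C0 = bilip_rel_pos[OF S(2)]
  obtain \<eta> where \<eta>: "\<eta> > 0"
    "\<And>u x z. u \<in> lists {1..N} \<Longrightarrow> x \<in> X.cyl u \<Longrightarrow> z \<in> E \<Longrightarrow> z \<notin> X.cyl u \<Longrightarrow> \<eta> * r u \<le> dist x z"
    using X.separated_cyl by metis
  \<comment> \<open>Chosen so that points of \<open>F\<close> within \<open>\<delta>\<close> of the
    magnified range have partners in \<open>E\<close> closer than the gap
    \<open>\<eta> * r u\<close> around the cylinder of \<open>u\<close>; the bound
    \<open>\<rho> v \<le> C * r u\<close> makes the choice independent of \<open>q\<close>.\<close>
  define \<delta> where "\<delta> = \<eta> / (C0 * K' * C)"
  have \<delta>: "\<delta> > 0" using \<eta>(1) C0 Y.K_pos C(1) by (simp add: \<delta>_def)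
  obtain m where m: "L' ^ Suc m * diameter F < \<delta>" using Y.power_L_small[OF \<delta>] by blast
  \<comment> \<open>Density at one scale implies density at all coarser ones, so
    \<open>P q w\<close> survives lowering \<open>q\<close>. As only finitely many \<open>w\<close>
    compete, one of them works for every \<open>q\<close>.\<close>
  define P where "P q w \<longleftrightarrow> (\<exists>R. R \<subseteq> E \<times> F \<and> bilip_rel C R \<and>
      (\<forall>x\<in>E. \<exists>x'\<in>Domain R. dist x x' \<le> L ^ Suc q * diameter E) \<and> Y.cyl w \<subseteq> Range R)" for q w
  have P_ex: "\<exists>w\<in>Y.words (Suc m). P q w" for q
  proof -
    obtain u v where u: "u \<in> lists {1..N}" and v: "v \<in> lists {1..M}" and R: "bilip_rel C (rescale u v S)"
      "\<And>w. w \<in> X.words (Suc q) \<Longrightarrow> Domain (rescale u v S) \<inter> X.cyl w \<noteq> {}"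
      and rho: "\<rho> v \<le> C * r u"
      using C(2)[of q] by metis
    have R_EF: "rescale u v S \<subseteq> E \<times> F" by (auto simp: rescale_rel_def)
    have dense: "\<forall>x\<in>E. \<exists>x'\<in>Domain (rescale u v S). dist x x' \<le> L ^ Suc q * diameter E"
      using X.dense_if_meets_cyls R(2) by blast
    obtain x y where xy: "(x, y) \<in> rescale u v S" using dense X.E_ne by blast
    then have xy': "x \<in> E" "y \<in> F" "(word_map f u x, word_map g v y) \<in> S" by (auto simp: rescale_rel_def)
    obtain w where w: "w \<in> Y.words (Suc m)" "y \<in> Y.cyl w" using Y.E_in_words xy'(2) by blast
    note w' = Y.wordsD[OF w(1)]
    have "Y.cyl w \<subseteq> Range (rescale u v S)"
    proof
      fix y' assume y': "y' \<in> Y.cyl w"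
      then have y'F: "y' \<in> F" using Y.cyl_subset_E w' by blast
      then have "word_map g v y' \<in> Range S" using S(3) Y.word_map_in_E v by blast
      then obtain z where z: "(z, word_map g v y') \<in> S" by blast
      have "dist y y' < \<delta>" using Y.dist_cyl_le[OF w'(1) w(2) y'] w'(2) m by simp
      have "dist (word_map f u x) z \<le> C0 * dist (word_map g v y) (word_map g v y')"
        by (rule bilip_relD(1)[OF S(2) xy'(3) z])
      also have "\<dots> \<le> C0 * (K' * \<rho> v * dist y y')"
        using C0 by (intro mult_left_mono Y.upper v xy' y'F) auto
      also have "\<dots> \<le> C0 * (K' * (C * r u) * dist y y')"
        using C0 Y.K_pos rho by (intro mult_left_mono mult_right_mono) auto
      also have "\<dots> = C0 * K' * C * r u * dist y y'" by simp
      also have "\<dots> < C0 * K' * C * r u * \<delta>"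
        using \<open>dist y y' < \<delta>\<close> C0 Y.K_pos C(1) X.r_pos[OF u] by (intro mult_strict_left_mono) auto
      also have "\<dots> = \<eta> * r u" using C0 Y.K_pos C(1) by (simp add: \<delta>_def)
      finally have "z \<in> X.cyl u"
        using \<eta>(2)[OF u, of "word_map f u x" z] xy'(1) z S(1) by (force simp: X.cyl_def)
      then obtain z' where "z' \<in> E" "z = word_map f u z'" by (auto simp: X.cyl_def)
      then have "(z', y') \<in> rescale u v S" using z y'F by (auto simp: rescale_rel_def)
      then show "y' \<in> Range (rescale u v S)" by blast
    qed
    then show ?thesis using w R R_EF dense unfolding P_def by blast
  qed
  have P_mono: "P q' w" if "P q w" "q' \<le> q" for q q' w
  proof -
    have "L ^ Suc q * diameter E \<le> L ^ Suc q' * diameter E"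
      using that(2) X.L_pos X.L_less X.diameter_nonneg by (intro mult_right_mono power_decreasing) auto
    then show ?thesis using that(1) unfolding P_def by (meson order_trans)
  qed
  have "\<exists>w\<in>Y.words (Suc m). \<forall>q. P q w"
  proof (rule ccontr)
    assume "\<not> ?thesis"
    then obtain q where q: "\<And>w. w \<in> Y.words (Suc m) \<Longrightarrow> \<not> P (q w) w" by metis
    \<comment> \<open>The sum is a level beyond all the failing ones, since it dominates each
      summand.\<close>
    obtain w where w: "w \<in> Y.words (Suc m)" "P (\<Sum>w\<in>Y.words (Suc m). q w) w" using P_ex by blast
    then show False using q[OF w(1)] P_mono[OF w(2)] member_le_sum[OF w(1), of q] Y.finite_words by auto
  qed
  then obtain w R where w: "w \<in> Y.words (Suc m)" and R: "\<And>q. R q \<subseteq> E \<times> F" "\<And>q. bilip_rel C (R q)"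
      "\<And>q x. x \<in> E \<Longrightarrow> \<exists>x'\<in>Domain (R q). dist x x' \<le> L ^ Suc q * diameter E" "\<And>q. Y.cyl w \<subseteq> Range (R q)"
    unfolding P_def by metis
  show ?thesis
    by (rule bilip_rel_limit[OF X.compact_E X.E_ne Y.compact_E X.power_L_tendsto R])
      (assumption, rule that[OF _ _ _ Y.wordsD(1)[OF w]])
qed

end

section \<open>Equivalence of two Cantor systems, the second with two maps\<close>

theorem cantor_systems_bilip_equiv:
  assumes X: "cantor_system E N f r K L" and Y: "cantor_system F 2 g \<rho> K' L'"
    and S: "S \<subseteq> E \<times> F" "bilip_rel C0 S"
    and s: "s > 0" "hausdorff_measure s E < \<infinity>" "hausdorff_measure s F < \<infinity>"
       "hausdorff_measure s (Domain S) > 0"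
  shows "bilip_equiv E F"
proof -
  interpret XY: cantor_pair E N f r K L F 2 g \<rho> K' L' using X Y by (simp add: cantor_pair_def)
  interpret YX: cantor_pair F 2 g \<rho> K' L' E N f r K L using X Y by (simp add: cantor_pair_def)
  obtain C1 R1 where R1: "R1 \<subseteq> E \<times> F" "bilip_rel C1 R1" "Domain R1 = E"
    using XY.embedding[OF S s(1,2,4)] by metis
  \<comment> \<open>Choosing partners gives a Lipschitz map from the range of \<open>R1\<close> onto
    \<open>E\<close>, so a null range would make \<open>E\<close> null.\<close>
  have pos: "hausdorff_measure s (Domain (R1\<inverse>)) > 0"
  proof (rule ccontr)
    assume "\<not> ?thesis"
    then have 0: "hausdorff_measure s (Range R1) = 0" by (simp add: Domain_converse)
    have "\<exists>x. (x, y) \<in> R1" if "y \<in> Range R1" for y using that by blast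
    then obtain k where k: "\<And>y. y \<in> Range R1 \<Longrightarrow> (k y, y) \<in> R1" by metis
    have "E \<subseteq> k ` Range R1"
    proof
      fix x assume "x \<in> E"
      then obtain y where y: "(x, y) \<in> R1" using R1(3) by blast
      then have "(k y, y) \<in> R1" using k by blast
      then have "x = k y" using bilip_relD(1)[OF R1(2) y] by fastforce
      then show "x \<in> k ` Range R1" using y by blast
    qed
    then have "hausdorff_measure s E \<le> hausdorff_measure s (k ` Range R1)" by (rule hausdorff_measure_mono)
    also have "\<dots> \<le> ennreal (C1 powr s) * hausdorff_measure s (Range R1)"
      using bilip_relD(1)[OF R1(2) k k] by (intro hausdorff_measure_lipschitz_image s bilip_rel_pos[OF R1(2)])
    finally have "hausdorff_measure s E = 0" using 0 by simp
    moreover have "hausdorff_measure s (Domain S) \<le> hausdorff_measure s E"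
      using S(1) by (intro hausdorff_measure_mono) auto
    ultimately show False using s(4) by simp
  qed
  \<comment> \<open>Reversing \<open>R1\<close> turns its full domain into the full range that is
    needed to cover a cylinder of \<open>E\<close> in the limit.\<close>
  have sub: "R1\<inverse> \<subseteq> F \<times> E" and ran: "Range (R1\<inverse>) = E" using R1(1,3) by blast+
  obtain C R w where R: "R \<subseteq> F \<times> E" "bilip_rel C R" "Domain R = F"
      and w: "w \<in> lists {1..N}" "XY.X.cyl w \<subseteq> Range R"
    by (rule YX.embedding_onto_cyl[OF sub bilip_rel_converse[OF R1(2)] ran s(1,3) pos])
  note C = bilip_rel_pos[OF R(2)]
  define D where "D = {x. \<exists>y\<in>XY.X.cyl w. (x, y) \<in> R}"
  have "bilip_rel C (R \<inter> UNIV \<times> XY.X.cyl w)" by (rule bilip_rel_subset[OF R(2)]) blast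
  moreover have "Domain (R \<inter> UNIV \<times> XY.X.cyl w) = D" "Range (R \<inter> UNIV \<times> XY.X.cyl w) = XY.X.cyl w"
    using w(2) unfolding D_def by blast+
  ultimately have "bilip_equiv D (XY.X.cyl w)" unfolding bilip_equiv_def by blast
  moreover have "bilip_equiv E (XY.X.cyl w)"
    unfolding XY.X.cyl_def by (rule XY.X.bilip_equiv_word_image[OF w(1)]) simp
  ultimately have "bilip_equiv E D" by (meson bilip_equiv_trans bilip_equiv_sym)
  moreover have "bilip_equiv D F"
  proof -
    obtain \<eta> where \<eta>: "\<eta> > 0"
      "\<And>u x z. u \<in> lists {1..N} \<Longrightarrow> x \<in> XY.X.cyl u \<Longrightarrow> z \<in> E \<Longrightarrow> z \<notin> XY.X.cyl u \<Longrightarrow> \<eta> * r u \<le> dist x z"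
      using XY.X.separated_cyl by metis
    \<comment> \<open>At level \<open>Suc p\<close> the images of the cylinders of \<open>F\<close>
      have diameter below the gap around the cylinder of \<open>w\<close>, so each of these
      cylinders lies in \<open>D\<close> or misses it.\<close>
    have "\<eta> * r w / C > 0" using \<eta>(1) XY.X.r_pos[OF w(1)] C by simp
    then obtain p where p: "L' ^ Suc p * diameter F < \<eta> * r w / C" using XY.Y.power_L_small by blast
    have "XY.Y.cyl v \<subseteq> D" if v: "v \<in> XY.Y.words (Suc p)" "XY.Y.cyl v \<inter> D \<noteq> {}" for v
    proof
      fix x' assume x': "x' \<in> XY.Y.cyl v"
      note v' = XY.Y.wordsD[OF v(1)]
      obtain x y where xy: "x \<in> XY.Y.cyl v" "y \<in> XY.X.cyl w" "(x, y) \<in> R" using v(2) by (auto simp: D_def)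
      have "x' \<in> F" using x' XY.Y.cyl_subset_E v' by blast
      then obtain y' where y': "(x', y') \<in> R" using R(3) by blast
      have "dist y y' \<le> C * dist x x'" by (rule bilip_relD(2)[OF R(2) xy(3) y'])
      also have "dist x x' < \<eta> * r w / C"
        using XY.Y.dist_cyl_le[OF v'(1) xy(1) x'] v'(2) p by simp
      finally have "dist y y' < \<eta> * r w" using C by (simp add: field_simps)
      then have "y' \<in> XY.X.cyl w" using \<eta>(2)[OF w(1) xy(2), of y'] y' R(1) by force
      then show "x' \<in> D" using y' by (auto simp: D_def)
    qed
    moreover have "D \<subseteq> F" "D \<noteq> {}"
      using R(1) w(2) XY.X.cyl_ne[of w] by (auto simp: D_def)
    ultimately show ?thesis by (intro XY.Y.bilip_equiv_cyl_union[where p = "Suc p"]) auto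
  qed
  ultimately show ?thesis by (rule bilip_equiv_trans)
qed

section \<open>Bounded distortion\<close>

text \<open>A conformal derivative stretches all directions equally, so its operator norm controls
  distances from below as well as from above.\<close>

lemma norm_conformal_derivative:
  fixes f :: "'a::euclidean_space \<Rightarrow> 'a"
  assumes "conformal_on V f" "x \<in> V"
  shows "norm (frechet_derivative f (at x) v) = onorm (frechet_derivative f (at x)) * norm v"
proof -
  obtain c T where T: "orthogonal_transformation T"
      and D: "frechet_derivative f (at x) = (\<lambda>v. c *\<^sub>R T v)"
    using assms unfolding conformal_on_def by blast
  have n: "norm (c *\<^sub>R T v) = \<bar>c\<bar> * norm v" for v
    using T by (simp add: orthogonal_transformation_norm)
  have lin: "bounded_linear (\<lambda>v. c *\<^sub>R T v)"
    using T by (intro bounded_linear_const_scaleR) (auto simp: orthogonal_transformation_linear linear_linear)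
  have "onorm (\<lambda>v. c *\<^sub>R T v) \<le> \<bar>c\<bar>" by (rule onorm_bound) (simp_all only: n abs_ge_zero order_refl)
  moreover obtain b :: 'a where "b \<in> Basis" using nonempty_Basis by blast
  then have "\<bar>c\<bar> \<le> onorm (\<lambda>v. c *\<^sub>R T v)" using onorm[OF lin, of b] unfolding n by simp
  ultimately show ?thesis unfolding D n by simp
qed

text \<open>The quotient of the two distances is continuous and positive on the compact set of pairs
  at distance at least \<open>\<rho>\<close>, hence has a positive minimum.\<close>

lemma injective_lower_lipschitz_far:
  fixes f :: "'a::heine_borel \<Rightarrow> 'b::metric_space"
  assumes "compact E" "continuous_on E f" "inj_on f E" "\<rho> > 0"
  obtains m where "m > 0" "\<And>x y. x \<in> E \<Longrightarrow> y \<in> E \<Longrightarrow> \<rho> \<le> dist x y \<Longrightarrow> m * dist x y \<le> dist (f x) (f y)"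
proof -
  define P where "P = (E \<times> E) \<inter> {p. \<rho> \<le> dist (fst p) (snd p)}"
  define F where "F p = dist (f (fst p)) (f (snd p)) / dist (fst p) (snd p)" for p
  have "compact P" unfolding P_def
    by (intro compact_Int_closed compact_Times assms closed_Collect_le continuous_intros)
  have F_pos: "F p > 0" if "p \<in> P" for p
  proof -
    have p: "fst p \<in> E" "snd p \<in> E" "fst p \<noteq> snd p" using that assms(4) by (auto simp: P_def)
    then have "f (fst p) \<noteq> f (snd p)" using inj_onD[OF assms(3)] by blast
    then show ?thesis using p by (simp add: F_def)
  qed
  show ?thesis
  proof (cases "P = {}")
    case True
    then show ?thesis by (intro that[of 1]) (auto simp: P_def)
  next
    case False
    have "continuous_on P F" unfolding F_def
      using assms(4) by (intro continuous_intros continuous_on_compose2[OF assms(2)]) (auto simp: P_def)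
    then obtain p where p: "p \<in> P" "\<And>q. q \<in> P \<Longrightarrow> F p \<le> F q"
      using continuous_attains_inf[OF \<open>compact P\<close> False] by metis
    show ?thesis
    proof (rule that[of "F p"])
      show "F p > 0" using F_pos p by blast
      fix x y assume "x \<in> E" "y \<in> E" "\<rho> \<le> dist x y"
      then have "F p \<le> F (x, y)" by (intro p) (auto simp: P_def)
      moreover have "dist x y > 0" using \<open>\<rho> \<le> _\<close> assms(4) by linarith
      ultimately show "F p * dist x y \<le> dist (f x) (f y)" by (simp add: F_def field_simps)
    qed
  qed
qed

lemma derivative_holder_bound:
  fixes f :: "'a::euclidean_space \<Rightarrow> 'a"
  assumes "C1_holder_on \<gamma> V f"
  obtains K where "K \<ge> 0" "\<And>x y v. x \<in> V \<Longrightarrow> y \<in> V \<Longrightarrow>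
     norm (frechet_derivative f (at x) v - frechet_derivative f (at y) v) \<le> K * dist x y powr \<gamma> * norm v"
proof -
  let ?D = "\<lambda>x. frechet_derivative f (at x)"
  obtain K0 where K0: "\<And>b x y. b \<in> Basis \<Longrightarrow> x \<in> V \<Longrightarrow> y \<in> V \<Longrightarrow>
      norm (?D x b - ?D y b) \<le> K0 * dist x y powr \<gamma>"
    and diff: "\<And>x. x \<in> V \<Longrightarrow> f differentiable (at x)"
    using assms unfolding C1_holder_on_def by blast
  have K0': "norm (?D x b - ?D y b) \<le> \<bar>K0\<bar> * dist x y powr \<gamma>" if "b \<in> Basis" "x \<in> V" "y \<in> V" for b x y
    using K0[OF that] mult_right_mono[OF abs_ge_self, of "dist x y powr \<gamma>" K0] by simp
  show ?thesis
  proof (rule that[of "DIM('a) * \<bar>K0\<bar>"])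
    fix x y v assume xy: "x \<in> V" "y \<in> V"
    have lin: "linear (?D x)" "linear (?D y)" using diff xy linear_frechet_derivative by blast+
    have expand: "?D z v = (\<Sum>b\<in>Basis. (v \<bullet> b) *\<^sub>R ?D z b)" if "linear (?D z)" for z
    proof -
      have "?D z v = ?D z (\<Sum>b\<in>Basis. (v \<bullet> b) *\<^sub>R b)" by (simp add: euclidean_representation)
      also have "\<dots> = (\<Sum>b\<in>Basis. (v \<bullet> b) *\<^sub>R ?D z b)" using that by (simp add: linear_sum linear_scale)
      finally show ?thesis .
    qed
    have "?D x v - ?D y v = (\<Sum>b\<in>Basis. (v \<bullet> b) *\<^sub>R (?D x b - ?D y b))"
      unfolding expand[OF lin(1)] expand[OF lin(2)] by (simp add: sum_subtractf scaleR_diff_right)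
    also have "norm \<dots> \<le> (\<Sum>b\<in>(Basis::'a set). norm v * (\<bar>K0\<bar> * dist x y powr \<gamma>))"
    proof (rule sum_norm_le)
      fix b :: 'a assume b: "b \<in> Basis"
      show "norm ((v \<bullet> b) *\<^sub>R (?D x b - ?D y b)) \<le> norm v * (\<bar>K0\<bar> * dist x y powr \<gamma>)"
        unfolding norm_scaleR using Basis_le_norm[OF b, of v] K0'[OF b xy] by (intro mult_mono) auto
    qed
    finally show "norm (?D x v - ?D y v) \<le> DIM('a) * \<bar>K0\<bar> * dist x y powr \<gamma> * norm v"
      by (simp add: mult_ac)
  qed auto
qed

text \<open>
  For nearby points this is the mean value inequality; for points at distance bounded below it follows
  from compactness and injectivity, at the price of enlarging \<open>M\<close>.
\<close>

lemma conformal_near_similarity: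
  fixes f :: "'a::euclidean_space \<Rightarrow> 'a"
  assumes V: "open V" and E: "compact E" "E \<subseteq> V" and inj: "inj_on f V"
    and conf: "conformal_on V f" and \<gamma>: "\<gamma> > 0" and holder: "C1_holder_on \<gamma> V f"
    and contr: "\<And>x y. x \<in> V \<Longrightarrow> y \<in> V \<Longrightarrow> dist (f x) (f y) \<le> dist x y"
    and a_def: "a = (\<lambda>x. onorm (frechet_derivative f (at x)))"
    and c: "c > 0" "\<And>x. x \<in> V \<Longrightarrow> c \<le> a x \<and> a x \<le> 1"
  obtains M where "M \<ge> 0"
    "\<And>x y. x \<in> E \<Longrightarrow> y \<in> E \<Longrightarrow> dist (f x) (f y) \<le> exp (M * dist x y powr \<gamma>) * a x * dist x y"
    "\<And>x y. x \<in> E \<Longrightarrow> y \<in> E \<Longrightarrow> a x * dist x y \<le> exp (M * dist x y powr \<gamma>) * dist (f x) (f y)"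
    "\<And>x y. x \<in> E \<Longrightarrow> y \<in> E \<Longrightarrow> a x \<le> exp (M * dist x y powr \<gamma>) * a y"
proof -
  let ?D = "\<lambda>x. frechet_derivative f (at x)"
  have a: "norm (?D x v) = a x * norm v" if "x \<in> V" for x v
    unfolding a_def using norm_conformal_derivative[OF conf that] by simp
  obtain K where K: "K \<ge> 0" "\<And>x y v. x \<in> V \<Longrightarrow> y \<in> V \<Longrightarrow> norm (?D x v - ?D y v) \<le> K * dist x y powr \<gamma> * norm v"
    using derivative_holder_bound[OF holder] by metis
  have der: "(f has_derivative ?D x) (at x)" if "x \<in> V" for x
    using holder that unfolding C1_holder_on_def by (simp add: frechet_derivative_works)
  have a_holder: "a x \<le> a y + K * dist x y powr \<gamma>" if "x \<in> V" "y \<in> V" for x y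
  proof -
    obtain b :: 'a where b: "b \<in> Basis" using nonempty_Basis by blast
    have "norm (?D x b) \<le> norm (?D y b) + norm (?D x b - ?D y b)" by norm
    then show ?thesis using K(2)[OF that, of b] b a that by simp
  qed
  obtain \<rho>' where \<rho>': "\<rho>' > 0" "(\<Union>x\<in>E. ball x \<rho>') \<subseteq> V"
    using compact_subset_open_imp_ball_epsilon_subset[OF E(1) V E(2)] by blast
  \<comment> \<open>Below this radius the balls around points of \<open>E\<close> stay in
    \<open>V\<close>, and the Hoelder error \<open>K * d powr \<gamma>\<close> is at most
    \<open>c / 2\<close>; \<open>K + 1\<close> avoids a division by 0.\<close>
  define \<rho> where "\<rho> = min \<rho>' ((c / (2 * (K + 1))) powr (1 / \<gamma>))"
  have \<rho>: "\<rho> > 0" using \<rho>' c K by (simp add: \<rho>_def)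
  have linear_approx: "\<bar>dist (f x) (f y) - a x * dist x y\<bar> \<le> K * dist x y powr \<gamma> * dist x y"
    if xy: "x \<in> E" "y \<in> E" "dist x y < \<rho>" for x y
  proof -
    \<comment> \<open>\<open>V\<close> is not assumed convex, so the linearization bound is applied
      on a ball.\<close>
    have sub: "cball x (dist x y) \<subseteq> V"
      using xy \<rho>'(2) by (auto simp: \<rho>_def subset_iff) (metis dist_commute mem_ball order_le_less_trans)
    have xV: "x \<in> V" using xy E by blast
    have "norm (f y - f x - ?D x (y - x)) \<le> norm (y - x) * (K * dist x y powr \<gamma>)"
    proof (rule differentiable_bound_linearization[where f' = ?D and S = "cball x (dist x y)"])
      show "x + t *\<^sub>R (y - x) \<in> cball x (dist x y)" if "t \<in> {0..1}" for t
        using that by (simp add: dist_norm norm_minus_commute mult_left_le_one_le)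
      show "(f has_derivative ?D z) (at z within cball x (dist x y))" if "z \<in> cball x (dist x y)" for z
        using der sub that by (blast intro: has_derivative_at_withinI)
      fix z assume z: "z \<in> cball x (dist x y)"
      have "onorm (?D z - ?D x) \<le> K * dist z x powr \<gamma>"
        by (rule onorm_bound) (use K z sub xV in auto)
      also have "\<dots> \<le> K * dist x y powr \<gamma>"
        using K z \<gamma> by (intro mult_left_mono powr_mono2) (auto simp: dist_commute)
      finally show "onorm (?D z - ?D x) \<le> K * dist x y powr \<gamma>" .
    qed auto
    moreover have "\<bar>norm (f y - f x) - norm (?D x (y - x))\<bar> \<le> norm (f y - f x - ?D x (y - x))"
      by (rule norm_triangle_ineq3)
    ultimately show ?thesis
      unfolding a[OF xV] by (simp add: dist_norm norm_minus_commute mult_ac)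
  qed
  have "continuous_on E f"
    by (rule has_derivative_continuous_on[OF has_derivative_at_withinI[OF der]]) (use E in auto)
  then obtain m where m: "m > 0" "\<And>x y. x \<in> E \<Longrightarrow> y \<in> E \<Longrightarrow> \<rho> \<le> dist x y \<Longrightarrow> m * dist x y \<le> dist (f x) (f y)"
    using injective_lower_lipschitz_far[OF E(1) _ inj_on_subset[OF inj E(2)] \<rho>] by metis
  define m' where "m' = min (min m c) 1"
  have m': "0 < m'" "m' \<le> m" "m' \<le> c" "m' \<le> 1" using m c by (auto simp: m'_def)
  \<comment> \<open>This makes \<open>exp (M2 * \<rho> powr \<gamma>)\<close> equal to
    \<open>1 / m'\<close>, which absorbs the estimates for distant pairs. The summand
    \<open>2 * K / c\<close> of \<open>M\<close> is for nearby pairs, through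
    \<open>1 \<le> (1 + 2 * t) * (1 - t)\<close> for \<open>0 \<le> t \<le> 1 / 2\<close>.\<close>
  define M2 where "M2 = ln (1 / m') / \<rho> powr \<gamma>"
  define M where "M = 2 * K / c + M2"
  have M2: "M2 \<ge> 0" unfolding M2_def using m' by (intro divide_nonneg_nonneg ln_ge_zero) auto
  have near: "1 + K * d powr \<gamma> / c \<le> exp (M * d powr \<gamma>)" "1 \<le> exp (M * d powr \<gamma>) * (1 - K * d powr \<gamma> / c)"
    if d: "0 \<le> d" "d < \<rho>" for d
  proof -
    define t where "t = K * d powr \<gamma> / c"
    have t0: "t \<ge> 0" using K c by (simp add: t_def)
    have "d powr \<gamma> \<le> ((c / (2 * (K + 1))) powr (1 / \<gamma>)) powr \<gamma>"
      using d \<gamma> by (intro powr_mono2) (auto simp: \<rho>_def)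
    also have "\<dots> = c / (2 * (K + 1))" using \<gamma> c K by (simp add: powr_powr)
    finally have "K * d powr \<gamma> \<le> (K + 1) * (c / (2 * (K + 1)))" using K by (intro mult_mono) auto
    also have "\<dots> = c / 2" using K(1) by (simp add: divide_simps)
    finally have t: "t \<le> 1 / 2" using c by (simp add: t_def field_simps)
    have "1 + 2 * t \<le> exp (2 * t)" by (rule exp_ge_add_one_self)
    also have "\<dots> \<le> exp (M * d powr \<gamma>)"
      using M2 by (simp add: t_def M_def distrib_right mult.assoc)
    finally have e: "1 + 2 * t \<le> exp (M * d powr \<gamma>)" .
    then show "1 + K * d powr \<gamma> / c \<le> exp (M * d powr \<gamma>)" using t0 by (simp add: t_def)
    have "0 \<le> t * (1 - 2 * t)" using t t0 by simp
    then have "1 \<le> (1 + 2 * t) * (1 - t)" by (simp add: algebra_simps)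
    also have "\<dots> \<le> exp (M * d powr \<gamma>) * (1 - t)" using t e by (intro mult_right_mono) auto
    finally show "1 \<le> exp (M * d powr \<gamma>) * (1 - K * d powr \<gamma> / c)" by (simp add: t_def)
  qed
  have far: "1 / m' \<le> exp (M * d powr \<gamma>)" if d: "d \<ge> \<rho>" for d
  proof -
    have "\<rho> powr \<gamma> \<le> d powr \<gamma>" using d \<rho> \<gamma> by (intro powr_mono2) auto
    then have "M2 * \<rho> powr \<gamma> \<le> M2 * d powr \<gamma>" using M2 by (rule mult_left_mono)
    also have "\<dots> \<le> M * d powr \<gamma>" using K c by (intro mult_right_mono) (auto simp: M_def)
    finally have "ln (1 / m') \<le> M * d powr \<gamma>" using \<rho> by (simp add: M2_def)
    then have "exp (ln (1 / m')) \<le> exp (M * d powr \<gamma>)" by simp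
    then show ?thesis using m' by simp
  qed
  show ?thesis
  proof (rule that[of M])
    show "M \<ge> 0" using M2 K c by (simp add: M_def)
    fix x y assume xy: "x \<in> E" "y \<in> E"
    then have xyV: "x \<in> V" "y \<in> V" using E by auto
    define d where "d = dist x y"
    have d0: "d \<ge> 0" by (simp add: d_def)
    have ax: "c \<le> a x" "a x \<le> 1" "c \<le> a y" using c(2) xyV by auto
    have t: "K * d powr \<gamma> * d \<le> a x * (K * d powr \<gamma> / c) * d"
    proof -
      have "c * (K * d powr \<gamma> / c) \<le> a x * (K * d powr \<gamma> / c)"
        using ax K c by (intro mult_right_mono) auto
      then show ?thesis using c d0 by (intro mult_right_mono) auto
    qed
    show "dist (f x) (f y) \<le> exp (M * dist x y powr \<gamma>) * a x * dist x y"
    proof (cases "d < \<rho>")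
      case True
      have "dist (f x) (f y) \<le> a x * d + K * d powr \<gamma> * d"
        using linear_approx[OF xy] True unfolding d_def by linarith
      also have "\<dots> \<le> a x * d * (1 + K * d powr \<gamma> / c)" using t by (simp add: algebra_simps)
      also have "\<dots> \<le> a x * d * exp (M * d powr \<gamma>)"
        using near(1)[OF d0 True] ax c d0 by (intro mult_left_mono) auto
      finally show ?thesis by (simp add: d_def mult_ac)
    next
      case False
      have "dist (f x) (f y) \<le> 1 * d" using contr xyV by (simp add: d_def)
      also have "1 * d \<le> 1 / m' * a x * d"
        using m' ax d0 by (intro mult_right_mono) (auto simp: field_simps)
      also have "\<dots> \<le> exp (M * d powr \<gamma>) * a x * d"
        using far[of d] False ax c d0 by (intro mult_right_mono) auto
      finally show ?thesis by (simp add: d_def)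
    qed
    show "a x * dist x y \<le> exp (M * dist x y powr \<gamma>) * dist (f x) (f y)"
    proof (cases "d < \<rho>")
      case True
      have "a x * d * 1 \<le> a x * d * (exp (M * d powr \<gamma>) * (1 - K * d powr \<gamma> / c))"
        using near(2)[OF d0 True] ax c d0 by (intro mult_left_mono) auto
      also have "\<dots> = exp (M * d powr \<gamma>) * (a x * d - a x * (K * d powr \<gamma> / c) * d)"
        by (simp add: algebra_simps)
      also have "\<dots> \<le> exp (M * d powr \<gamma>) * dist (f x) (f y)"
        using linear_approx[OF xy] True t unfolding d_def by (intro mult_left_mono) auto
      finally show ?thesis by (simp add: d_def)
    next
      case False
      have "a x * d \<le> 1 * d" using ax d0 by (intro mult_right_mono) auto
      also have "\<dots> \<le> 1 / m' * m * d"
        using m' d0 by (intro mult_right_mono) (auto simp: field_simps)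
      also have "1 / m' * m * d = 1 / m' * (m * d)" by simp
      also have "\<dots> \<le> 1 / m' * dist (f x) (f y)"
        using m(2)[OF xy] False m' unfolding d_def by (intro mult_left_mono) auto
      also have "\<dots> \<le> exp (M * d powr \<gamma>) * dist (f x) (f y)"
        using far[of d] False by (intro mult_right_mono) auto
      finally show ?thesis by (simp add: d_def)
    qed
    have "a x \<le> a y + K * d powr \<gamma>" unfolding d_def by (rule a_holder[OF xyV])
    also have "\<dots> \<le> a y * (1 + K / c * d powr \<gamma>)"
    proof -
      have "c * (K / c * d powr \<gamma>) \<le> a y * (K / c * d powr \<gamma>)" using ax K c by (intro mult_right_mono) auto
      then show ?thesis using c by (simp add: distrib_left)
    qed
    also have "\<dots> \<le> a y * exp (M * d powr \<gamma>)"
    proof (rule mult_left_mono)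
      have "1 + K / c * d powr \<gamma> \<le> exp (K / c * d powr \<gamma>)" by (rule exp_ge_add_one_self)
      also have "K / c * d powr \<gamma> \<le> M * d powr \<gamma>"
        using M2 K(1) c(1) by (intro mult_right_mono) (auto simp: M_def intro!: add_increasing2 divide_right_mono)
      finally show "1 + K / c * d powr \<gamma> \<le> exp (M * d powr \<gamma>)" by simp
    qed (use ax c in auto)
    finally show "a x \<le> exp (M * dist x y powr \<gamma>) * a y" by (simp add: d_def mult_ac)
  qed
qed

text \<open>When \<open>a i\<close> is the stretching factor of \<open>f i\<close>, the chain rule
  makes this the stretching factor of \<open>word_map f w\<close> at \<open>x\<close>; the product
  form avoids differentiating compositions.\<close>

primrec word_ratio :: "(nat \<Rightarrow> 'a \<Rightarrow> 'a) \<Rightarrow> (nat \<Rightarrow> 'a \<Rightarrow> real) \<Rightarrow> nat list \<Rightarrow> 'a \<Rightarrow> real" where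
  "word_ratio f a [] x = 1"
| "word_ratio f a (i # w) x = a i (word_map f w x) * word_ratio f a w x"

text \<open>
  Along a word the errors \<open>M d\<^sup>\<gamma>\<close> of the single maps decay geometrically, because the points
  approach each other at rate \<open>L\<close>.
\<close>

lemma bounded_distortion:
  fixes f :: "nat \<Rightarrow> 'a::metric_space \<Rightarrow> 'a"
  assumes f_in: "\<And>i x. i \<in> I \<Longrightarrow> x \<in> E \<Longrightarrow> f i x \<in> E"
    and L: "0 < L" "L < 1"
    and contr: "\<And>i x y. i \<in> I \<Longrightarrow> x \<in> E \<Longrightarrow> y \<in> E \<Longrightarrow> dist (f i x) (f i y) \<le> L * dist x y"
    and \<gamma>: "\<gamma> > 0" and M: "M \<ge> 0" and a: "\<And>i x. i \<in> I \<Longrightarrow> x \<in> E \<Longrightarrow> a i x > 0"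
    and step: "\<And>i x y. i \<in> I \<Longrightarrow> x \<in> E \<Longrightarrow> y \<in> E \<Longrightarrow> dist (f i x) (f i y) \<le> exp (M * dist x y powr \<gamma>) * a i x * dist x y"
      "\<And>i x y. i \<in> I \<Longrightarrow> x \<in> E \<Longrightarrow> y \<in> E \<Longrightarrow> a i x * dist x y \<le> exp (M * dist x y powr \<gamma>) * dist (f i x) (f i y)"
      "\<And>i x y. i \<in> I \<Longrightarrow> x \<in> E \<Longrightarrow> y \<in> E \<Longrightarrow> a i x \<le> exp (M * dist x y powr \<gamma>) * a i y"
    and w: "w \<in> lists I" and xy: "x \<in> E" "y \<in> E"
  defines "S \<equiv> (\<lambda>n. \<Sum>j<n. (L powr \<gamma>) ^ j)"
  shows "word_map f w x \<in> E \<and> word_ratio f a w x > 0 \<and>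
     dist (word_map f w x) (word_map f w y) \<le> L ^ length w * dist x y \<and>
     dist (word_map f w x) (word_map f w y) \<le> exp (M * S (length w) * dist x y powr \<gamma>) * word_ratio f a w x * dist x y \<and>
     word_ratio f a w x * dist x y \<le> exp (M * S (length w) * dist x y powr \<gamma>) * dist (word_map f w x) (word_map f w y) \<and>
     word_ratio f a w x \<le> exp (M * S (length w) * dist x y powr \<gamma>) * word_ratio f a w y"
  using w xy
proof (induction w arbitrary: x y rule: list.induct)
  case Nil
  then show ?case by (simp add: S_def)
next
  case (Cons i w)
  let ?n = "length w"
  define x' y' d d' R where "x' = word_map f w x" "y' = word_map f w y" "d = dist x y" "d' = dist x' y'"
     "R = word_ratio f a w x"
  note defs = this
  define e where "e = exp (M * S ?n * d powr \<gamma>)"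
  have i: "i \<in> I" using Cons.prems by simp
  have IH: "x' \<in> E" "R > 0" "d' \<le> L ^ ?n * d" "d' \<le> e * R * d" "R * d \<le> e * d'" "R \<le> e * word_ratio f a w y"
    using Cons.IH[of x y] Cons.prems unfolding defs e_def by auto
  \<comment> \<open>Taking \<open>y\<close> for both points supplies membership and positivity at
    \<open>y\<close>, which the induction hypothesis states only for its first point.\<close>
  have IH': "y' \<in> E" "word_ratio f a w y > 0" using Cons.IH[of y y] Cons.prems unfolding defs by auto
  have aw: "a i x' > 0" "a i y' > 0" using a i IH IH' by auto
  define \<epsilon> where "\<epsilon> = exp (M * d' powr \<gamma>)"
  have pos: "\<epsilon> > 0" "e > 0" by (auto simp: \<epsilon>_def e_def)
  have d0: "d \<ge> 0" "d' \<ge> 0" by (auto simp: defs)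
  \<comment> \<open>The contraction turns the error of the next map into the next term of the
    geometric sum \<open>S\<close>.\<close>
  have "d' powr \<gamma> \<le> (L ^ ?n * d) powr \<gamma>" using IH(3) d0 \<gamma> by (intro powr_mono2) auto
  also have "\<dots> = (L powr \<gamma>) ^ ?n * d powr \<gamma>"
    using L by (simp add: powr_mult powr_powr powr_power mult.commute flip: powr_realpow)
  finally have "M * d' powr \<gamma> \<le> M * ((L powr \<gamma>) ^ ?n * d powr \<gamma>)" using M by (rule mult_left_mono)
  then have "M * d' powr \<gamma> + M * S ?n * d powr \<gamma> \<le> M * S (Suc ?n) * d powr \<gamma>"
    by (simp add: S_def algebra_simps)
  then have "\<epsilon> * e \<le> exp (M * S (Suc ?n) * d powr \<gamma>)" (is "_ \<le> ?e'")
    unfolding \<epsilon>_def e_def by (simp flip: exp_add)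
  then have e': "\<epsilon> * e * c \<le> ?e' * c" if "c \<ge> 0" for c using that by (rule mult_right_mono)
  have 1: "dist (f i x') (f i y') \<le> L * d'" using contr i IH IH' unfolding defs by blast
  have 2: "dist (f i x') (f i y') \<le> \<epsilon> * a i x' * d'"
    using step(1)[OF i IH(1) IH'(1)] unfolding \<epsilon>_def defs by simp
  have 3: "a i x' * d' \<le> \<epsilon> * dist (f i x') (f i y')"
    using step(2)[OF i IH(1) IH'(1)] unfolding \<epsilon>_def defs by simp
  have 4: "a i x' \<le> \<epsilon> * a i y'"
    using step(3)[OF i IH(1) IH'(1)] unfolding \<epsilon>_def defs by simp
  have "dist (f i x') (f i y') \<le> L * (L ^ ?n * d)" using 1 IH(3) L by (meson mult_left_mono order_trans less_imp_le)
  moreover have "dist (f i x') (f i y') \<le> ?e' * (a i x' * R) * d"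
  proof -
    have "\<epsilon> * a i x' * d' \<le> \<epsilon> * a i x' * (e * R * d)" using IH(4) pos aw by (intro mult_left_mono) auto
    also have "\<dots> = \<epsilon> * e * (a i x' * R * d)" by simp
    also have "\<dots> \<le> ?e' * (a i x' * R * d)" using aw IH(2) d0 by (intro e') auto
    finally show ?thesis using 2 by simp
  qed
  moreover have "a i x' * R * d \<le> ?e' * dist (f i x') (f i y')"
  proof -
    have "a i x' * (R * d) \<le> a i x' * (e * d')" using IH(5) aw by (intro mult_left_mono) auto
    also have "\<dots> = e * (a i x' * d')" by simp
    also have "\<dots> \<le> e * (\<epsilon> * dist (f i x') (f i y'))" using 3 pos by (intro mult_left_mono) auto
    also have "\<dots> = \<epsilon> * e * dist (f i x') (f i y')" by simp
    also have "\<dots> \<le> ?e' * dist (f i x') (f i y')" by (rule e') simp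
    finally show ?thesis by simp
  qed
  moreover have "a i x' * R \<le> ?e' * (a i y' * word_ratio f a w y)"
  proof -
    have "a i x' * R \<le> (\<epsilon> * a i y') * (e * word_ratio f a w y)"
      using 4 IH aw pos by (intro mult_mono) auto
    also have "\<dots> = \<epsilon> * e * (a i y' * word_ratio f a w y)" by simp
    also have "\<dots> \<le> ?e' * (a i y' * word_ratio f a w y)" using aw IH' by (intro e') auto
    finally show ?thesis .
  qed
  moreover have "f i x' \<in> E" using f_in i IH by blast
  moreover have "a i x' * R > 0" using aw IH by simp
  ultimately show ?case by (simp add: defs)
qed

section \<open>Conformal systems with strong separation as Cantor systems\<close>

theorem conformal_ifs_cantor_system:
  fixes E :: "'a::euclidean_space set"
  assumes ifs: "conformal_ifs V N f" and inv: "invariant_set V N f E" and sep: "strong_separation N f E"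
  obtains r K L where "cantor_system E N f r K L"
proof -
  have E: "E \<noteq> {}" "compact E" "E \<subseteq> V" "E = (\<Union>i\<in>{1..N}. f i ` E)"
    using inv by (auto simp: invariant_set_def)
  have N: "2 \<le> N" and V: "open V"
    and f: "\<And>i. i \<in> {1..N} \<Longrightarrow> inj_on (f i) V \<and> conformal_on V (f i)"
    using ifs by (auto simp: conformal_ifs_def)
  obtain \<gamma> where \<gamma>: "\<gamma> > 0" "\<And>i. i \<in> {1..N} \<Longrightarrow> C1_holder_on \<gamma> V (f i)"
    using ifs unfolding conformal_ifs_def by blast
  obtain L0 where L0: "L0 < 1" "\<And>i x y. i \<in> {1..N} \<Longrightarrow> x \<in> V \<Longrightarrow> y \<in> V \<Longrightarrow> dist (f i x) (f i y) \<le> L0 * dist x y"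
    using ifs unfolding conformal_ifs_def by blast
  define a where "a i = (\<lambda>x. onorm (frechet_derivative (f i) (at x)))" for i
  obtain c where c: "c > 0" "\<And>i x. i \<in> {1..N} \<Longrightarrow> x \<in> V \<Longrightarrow> c \<le> a i x \<and> a i x \<le> 1"
    using ifs unfolding conformal_ifs_def a_def by (meson less_imp_le order_trans)
  \<comment> \<open>\<open>L0\<close> is only bounded from above; the maximum makes the rate
    positive.\<close>
  define L where "L = max L0 (1 / 2)"
  have L: "0 < L" "L < 1" using L0 by (auto simp: L_def)
  have contr: "dist (f i x) (f i y) \<le> L * dist x y" if "i \<in> {1..N}" "x \<in> V" "y \<in> V" for i x y
    using L0(2)[OF that] mult_right_mono[of L0 L "dist x y"] by (simp add: L_def)
  have contr1: "dist (f i x) (f i y) \<le> dist x y" if "i \<in> {1..N}" "x \<in> V" "y \<in> V" for i x y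
    using contr[OF that] mult_right_mono[of L 1 "dist x y"] L by simp
  define est where "est i M \<longleftrightarrow> (\<forall>x\<in>E. \<forall>y\<in>E.
      dist (f i x) (f i y) \<le> exp (M * dist x y powr \<gamma>) * a i x * dist x y \<and>
      a i x * dist x y \<le> exp (M * dist x y powr \<gamma>) * dist (f i x) (f i y) \<and>
      a i x \<le> exp (M * dist x y powr \<gamma>) * a i y)" for i M
  have "\<exists>M\<ge>0. est i M" if i: "i \<in> {1..N}" for i
  proof -
    obtain M where "M \<ge> 0" "est i M"
      by (rule conformal_near_similarity[OF V E(2,3) f[OF i, THEN conjunct1] f[OF i, THEN conjunct2]
            \<gamma>(1) \<gamma>(2)[OF i] contr1[OF i] a_def c(1) c(2)[OF i]]) (auto simp: est_def)
    then show ?thesis by blast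
  qed
  then obtain M where M: "\<And>i. i \<in> {1..N} \<Longrightarrow> M i \<ge> 0" "\<And>i. i \<in> {1..N} \<Longrightarrow> est i (M i)" by metis
  define M' where "M' = (\<Sum>i\<in>{1..N}. M i)"
  have M': "M' \<ge> 0" unfolding M'_def using M by (intro sum_nonneg) auto
  have a_pos: "a i x > 0" if "i \<in> {1..N}" "x \<in> E" for i x
    using c(2)[OF that(1), of x] that E(3) c(1) by fastforce
  have exp_le: "exp (M i * dist x y powr \<gamma>) * t \<le> exp (M' * dist x y powr \<gamma>) * t"
    if "i \<in> {1..N}" "t \<ge> 0" for i t and x y :: 'a
  proof -
    have "M i \<le> M'" unfolding M'_def using that M by (intro member_le_sum) auto
    then have "M i * dist x y powr \<gamma> \<le> M' * dist x y powr \<gamma>" by (intro mult_right_mono) auto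
    then show ?thesis using that by (intro mult_right_mono) auto
  qed
  have step: "dist (f i x) (f i y) \<le> exp (M' * dist x y powr \<gamma>) * a i x * dist x y"
      "a i x * dist x y \<le> exp (M' * dist x y powr \<gamma>) * dist (f i x) (f i y)"
      "a i x \<le> exp (M' * dist x y powr \<gamma>) * a i y"
    if *: "i \<in> {1..N}" "x \<in> E" "y \<in> E" for i x y
  proof -
    have "0 \<le> a i x * dist x y" "0 \<le> a i y" using a_pos[OF *(1)] * by (auto simp: less_imp_le)
    then show "dist (f i x) (f i y) \<le> exp (M' * dist x y powr \<gamma>) * a i x * dist x y"
      "a i x * dist x y \<le> exp (M' * dist x y powr \<gamma>) * dist (f i x) (f i y)"
      "a i x \<le> exp (M' * dist x y powr \<gamma>) * a i y"
      using M(2)[OF *(1)] * exp_le[OF *(1)] unfolding est_def mult.assoc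
      by (meson order_trans zero_le_dist)+
  qed
  have f_E: "f i x \<in> E" if "i \<in> {1..N}" "x \<in> E" for i x using E(4) that by blast
  have contr_E: "dist (f i x) (f i y) \<le> L * dist x y" if "i \<in> {1..N}" "x \<in> E" "y \<in> E" for i x y
    using contr that E(3) by blast
  obtain x0 where x0: "x0 \<in> E" using E by blast
  define \<mu> where "\<mu> = L powr \<gamma>"
  have \<mu>: "0 \<le> \<mu>" "\<mu> < 1" using L \<gamma>(1) powr_less_mono2[of \<gamma> L 1] by (auto simp: \<mu>_def)
  \<comment> \<open>The full geometric series and the diameter of \<open>E\<close> bound the
    distortion for all words and all pairs of points.\<close>
  define Q where "Q = exp (M' * (1 / (1 - \<mu>)) * diameter E powr \<gamma>)"
  have Q1: "Q \<ge> 1" using M' \<mu> by (simp add: Q_def)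
  \<comment> \<open>The ratio is read at a fixed base point. Moving from there to another point
    costs one factor \<open>Q\<close> and the distance estimate a second one, hence the constant
    \<open>Q * Q\<close>.\<close>
  define r where "r w = word_ratio f a w x0" for w
  have dist_diam: "dist x y \<le> diameter E" if "x \<in> E" "y \<in> E" for x y
    using that E(2) by (intro diameter_bounded_bound compact_imp_bounded)
  have words: "word_ratio f a w x > 0"
      "dist (word_map f w x) (word_map f w y) \<le> Q * word_ratio f a w x * dist x y"
      "word_ratio f a w x * dist x y \<le> Q * dist (word_map f w x) (word_map f w y)"
      "word_ratio f a w x \<le> Q * word_ratio f a w y"
    if w: "w \<in> lists {1..N}" and xy: "x \<in> E" "y \<in> E" for w x y
  proof -
    let ?e = "exp (M' * (\<Sum>j<length w. \<mu> ^ j) * dist x y powr \<gamma>)"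
    have b: "word_map f w x \<in> E \<and> word_ratio f a w x > 0 \<and>
       dist (word_map f w x) (word_map f w y) \<le> L ^ length w * dist x y \<and>
       dist (word_map f w x) (word_map f w y) \<le> exp (M' * (\<Sum>j<length w. \<mu> ^ j) * dist x y powr \<gamma>) * word_ratio f a w x * dist x y \<and>
       word_ratio f a w x * dist x y \<le> exp (M' * (\<Sum>j<length w. \<mu> ^ j) * dist x y powr \<gamma>) * dist (word_map f w x) (word_map f w y) \<and>
       word_ratio f a w x \<le> exp (M' * (\<Sum>j<length w. \<mu> ^ j) * dist x y powr \<gamma>) * word_ratio f a w y"
      if "x \<in> E" "y \<in> E" for x y
      unfolding \<mu>_def
      by (rule bounded_distortion[where f = f and a = a and I = "{1..N}" and E = E,
            OF f_E L contr_E \<gamma>(1) M' a_pos step w that])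
    have "(\<Sum>j<length w. \<mu> ^ j) \<le> (\<Sum>j. \<mu> ^ j)" using \<mu> by (intro sum_le_suminf) auto
    also have "\<dots> = 1 / (1 - \<mu>)" using \<mu> by (intro suminf_geometric) auto
    finally have "M' * (\<Sum>j<length w. \<mu> ^ j) * dist x y powr \<gamma> \<le> M' * (1 / (1 - \<mu>)) * diameter E powr \<gamma>"
      using M' \<mu> \<gamma> dist_diam[OF xy] by (intro mult_mono powr_mono2 sum_nonneg mult_left_mono mult_nonneg_nonneg) auto
    then have Q: "?e * t \<le> Q * t" if "t \<ge> 0" for t
      using that unfolding Q_def by (intro mult_right_mono) auto
    show pos: "word_ratio f a w x > 0" using b[OF xy] by blast
    have pos': "word_ratio f a w y > 0" using b[OF xy(2,1)] by blast
    have "dist (word_map f w x) (word_map f w y) \<le> ?e * word_ratio f a w x * dist x y" using b[OF xy] by blast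
    also have "\<dots> = ?e * (word_ratio f a w x * dist x y)" by (rule mult.assoc)
    also have "\<dots> \<le> Q * (word_ratio f a w x * dist x y)" using pos by (intro Q) simp
    finally show "dist (word_map f w x) (word_map f w y) \<le> Q * word_ratio f a w x * dist x y"
      by (simp add: mult.assoc)
    have "word_ratio f a w x * dist x y \<le> ?e * dist (word_map f w x) (word_map f w y)" using b[OF xy] by blast
    also have "\<dots> \<le> Q * dist (word_map f w x) (word_map f w y)" by (rule Q) simp
    finally show "word_ratio f a w x * dist x y \<le> Q * dist (word_map f w x) (word_map f w y)" .
    have "word_ratio f a w x \<le> ?e * word_ratio f a w y" using b[OF xy] by blast
    also have "\<dots> \<le> Q * word_ratio f a w y" using pos' by (intro Q) simp
    finally show "word_ratio f a w x \<le> Q * word_ratio f a w y" .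
  qed
  have "cantor_system E N f r (Q * Q) L"
  proof (unfold_locales)
    show "disjoint_family_on (\<lambda>i. f i ` E) {1..N}" using sep by (simp add: strong_separation_def)
    show "E = (\<Union>i\<in>{1..N}. f i ` E)" by fact
    show "1 \<le> Q * Q" using Q1 mult_mono[of 1 Q 1 Q] by simp
    show "r w > 0" if "w \<in> lists {1..N}" for w using words(1)[OF that x0 x0] by (simp add: r_def)
    fix w x y assume *: "w \<in> lists {1..N}" "x \<in> E" "y \<in> E"
    have "dist (word_map f w x) (word_map f w y) \<le> Q * word_ratio f a w x * dist x y" by (rule words[OF *])
    also have "\<dots> \<le> Q * (Q * r w) * dist x y"
      unfolding r_def using Q1 by (intro mult_right_mono mult_left_mono words * x0) auto
    finally show "dist (word_map f w x) (word_map f w y) \<le> Q * Q * r w * dist x y" by (simp add: mult_ac)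
    have "r w * dist x y \<le> Q * word_ratio f a w x * dist x y"
      unfolding r_def by (intro mult_right_mono words * x0) auto
    also have "\<dots> = Q * (word_ratio f a w x * dist x y)" by simp
    also have "\<dots> \<le> Q * (Q * dist (word_map f w x) (word_map f w y))"
      using Q1 by (intro mult_left_mono words *) auto
    finally show "r w * dist x y \<le> Q * Q * dist (word_map f w x) (word_map f w y)" by (simp add: mult_ac)
  qed (use E N L contr_E in auto)
  then show ?thesis by (rule that)
qed

theorem theorem4p2:
  fixes V E E' :: "(real ^ 'n) set"
    and W F :: "(real ^ 'p) set"
    and f :: "nat \<Rightarrow> real ^ 'n \<Rightarrow> real ^ 'n"
    and g :: "nat \<Rightarrow> real ^ 'p \<Rightarrow> real ^ 'p"
    and h :: "real ^ 'n \<Rightarrow> real ^ 'p"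
    and N :: nat
    and s :: real
  assumes "conformal_ifs V N f" and "open_set_condition V N f"
    and "invariant_set V N f E" and "strong_separation N f E"
    and "conformal_ifs W 2 g" and "open_set_condition W 2 g"
    and "invariant_set W 2 g F" and "strong_separation 2 g F"
    and "hausdorff_dim E = ereal s" and "hausdorff_dim F = ereal s"
    and "E' \<subseteq> E" and "hausdorff_measurable s E'" and "hausdorff_measure s E' > 0"
    and "bilipschitz_map h E' F"
  shows "\<exists>h' :: real ^ 'n \<Rightarrow> real ^ 'p. bilipschitz_map h' E F \<and> h' ` E = F"
proof -
  obtain r K L where X: "cantor_system E N f r K L"
    by (rule conformal_ifs_cantor_system[OF assms(1,3,4)])
  obtain \<rho> K' L' where Y: "cantor_system F 2 g \<rho> K' L'"
    by (rule conformal_ifs_cantor_system[OF assms(5,7,8)])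
  obtain C where C: "bilip_rel C {(x, h x) |x. x \<in> E'}"
    by (rule bilip_rel_graph[OF assms(14)])
  have sub: "{(x, h x) |x. x \<in> E'} \<subseteq> E \<times> F"
    using assms(11,14) unfolding bilipschitz_map_def by blast
  have dom: "Domain {(x, h x) |x. x \<in> E'} = E'" by blast
  have "bilip_equiv E F"
    by (rule cantor_systems_bilip_equiv[OF X Y sub C cantor_system.hausdorff_dim_pos[OF X]
          cantor_system.hausdorff_measure_finite[OF X] cantor_system.hausdorff_measure_finite[OF Y]])
       (use assms(9,10,13) dom in auto)
  then show ?thesis by (rule bilip_equiv_imp_bilipschitz_map)
qed

end
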